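(* Let $A\in[2,\infty)$, $N\ge 2$, and let $m_0,\dots,m_{N-1}>0$. For each ordering of the $N$ masses on a line there is, up to rotation about the origin, a unique central configuration (critical point of $f$) whose bodies lie on a line in that order, and its (planar) Morse index, i.e. its Morse index as a critical point of $f$ on $\mathcal{C}_N$, is $N-2$.
   Context: For $N$ bodies with masses $m_i$ at positions $q_i\in\mathbb{R}^2$, $i\in\{0,\dots,N-1\}$, let $r_{i,k}=|q_i-q_k|$, $M=\sum_i m_i$, $I=\sum_i m_i|q_i|^2$, and $$f=\frac{MI}{2}+\frac{1}{A-2}\sum_{i<k}m_im_k r_{i,k}^{2-A}\ \ (A>2),\qquad f=\frac{MI}{2}-\sum_{i<k}m_im_k\log r_{i,k}\ \ (A=2).$$ Central configurations are by definition the critical points of $f$ on $\mathbb{R}^{2N}\setminus\Delta$, where $\Delta$ is the set of configurations with $q_i=q_j$ for some $i\ne j$ (all of them have center of mass at the origin, and the scale is fixed by $f$). The configuration space is $\mathcal{C}_N=(\mathbb{R}^{2N}\setminus\Delta)/S^1$, with $S^1$ acting on $(\mathbb{R}^2)^N$ by simultaneous rotation about the origin; $f$ descends to $\mathcal{C}_N$. The Morse index of a critical point is the maximal dimension of a subspace of the tangent space on which the Hessian of $f$ (on $\mathcal{C}_N$) is negative definite. *)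

theory Defs
  imports "HOL-Analysis.Analysis"
begin

text \<open>
  The bodies are indexed by a finite linearly ordered type \<open>'n\<close>, so \<open>CARD('n)\<close> is the number
  of bodies; the order of \<open>'n\<close> plays the role of the order of the labels \<open>0, \<dots>, N - 1\<close>.
\<close>

type_synonym 'n configuration = "((real, 2) vec, 'n) vec"

definition collision_set :: "('n::finite) configuration set" where
  "collision_set = {q. \<exists>i j. i \<noteq> j \<and> q $ i = q $ j}"

definition total_mass :: "('n::finite \<Rightarrow> real) \<Rightarrow> real" where
  "total_mass m = (\<Sum>i\<in>UNIV. m i)"

definition moment_of_inertia :: "('n::finite \<Rightarrow> real) \<Rightarrow> 'n configuration \<Rightarrow> real" where
  "moment_of_inertia m q = (\<Sum>i\<in>UNIV. m i * (norm (q $ i))\<^sup>2)"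

definition potential ::
    "real \<Rightarrow> ('n::{finite,linorder} \<Rightarrow> real) \<Rightarrow> 'n configuration \<Rightarrow> real" where
  "potential A m q =
     (if A = 2
      then total_mass m * moment_of_inertia m q / 2
           - (\<Sum>(i, k)\<in>{(i, k). i < k}. m i * m k * ln (dist (q $ i) (q $ k)))
      else total_mass m * moment_of_inertia m q / 2
           + 1 / (A - 2) *
             (\<Sum>(i, k)\<in>{(i, k). i < k}. m i * m k * dist (q $ i) (q $ k) powr (2 - A)))"

definition central_configuration ::
    "real \<Rightarrow> ('n::{finite,linorder} \<Rightarrow> real) \<Rightarrow> 'n configuration \<Rightarrow> bool" where
  "central_configuration A m q \<longleftrightarrow>
     q \<notin> collision_set \<and> (potential A m has_derivative (\<lambda>v. 0)) (at q)"

definition rotate_config :: "real \<Rightarrow> ('n::finite) configuration \<Rightarrow> 'n configuration" where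
  "rotate_config \<theta> q =
     (\<chi> i. vector [cos \<theta> * q $ i $ 1 - sin \<theta> * q $ i $ 2,
                   sin \<theta> * q $ i $ 1 + cos \<theta> * q $ i $ 2])"

definition rotation_relation :: "(('n::finite) configuration \<times> 'n configuration) set" where
  "rotation_relation =
     {(q, q'). q \<notin> collision_set \<and> q' \<notin> collision_set \<and> (\<exists>\<theta>. q' = rotate_config \<theta> q)}"

definition configuration_space :: "('n::finite) configuration set set" where
  "configuration_space = (- collision_set) // rotation_relation"

text \<open>
  Position \<open>i\<close> on the line, counted in the direction \<open>u\<close>, is occupied by body \<open>\<sigma> i\<close>. The line
  is not required to pass through the origin.
\<close>

definition on_line_in_order ::
    "('n::{finite,linorder} \<Rightarrow> 'n) \<Rightarrow> 'n configuration \<Rightarrow> bool" where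
  "on_line_in_order \<sigma> q \<longleftrightarrow>
     (\<exists>p u t. u \<noteq> 0 \<and> strict_mono t \<and> (\<forall>i. q $ (\<sigma> i) = p + t i *\<^sub>R u))"

definition hessian :: "('a::real_normed_vector \<Rightarrow> real) \<Rightarrow> 'a \<Rightarrow> 'a \<Rightarrow> 'a \<Rightarrow> real" where
  "hessian f q v w = frechet_derivative (\<lambda>x. frechet_derivative f (at x) v) (at q) w"

definition orbit_tangent :: "('n::finite) configuration \<Rightarrow> 'n configuration set" where
  "orbit_tangent q = span {vector_derivative (\<lambda>\<theta>. rotate_config \<theta> q) (at 0)}"

text \<open>
  The tangent space of the configuration space at the orbit of \<open>q\<close> is the quotient of the space
  of all \<open>v :: 'n configuration\<close> by \<open>K = orbit_tangent q\<close>, and at a critical point \<open>q\<close> the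
  Hessian of the induced function sends the classes of \<open>v\<close> and \<open>w\<close> to
  \<open>hessian (potential A m) q v w\<close>. A subspace of this quotient is \<open>W / K\<close> for a unique subspace
  \<open>W\<close> containing \<open>K\<close>; its dimension is \<open>dim W - dim K\<close>, and its nonzero elements are the
  classes of the elements of \<open>W - K\<close>.
\<close>

definition morse_index ::
    "real \<Rightarrow> ('n::{finite,linorder} \<Rightarrow> real) \<Rightarrow> 'n configuration \<Rightarrow> nat" where
  "morse_index A m q =
     Max {dim W - dim (orbit_tangent q) | W.
            subspace W \<and> orbit_tangent q \<subseteq> W \<and>
            (\<forall>w \<in> W - orbit_tangent q. hessian (potential A m) q w w < 0)}"

end

theory Submission
  imports Defs
begin

text \<open>
  On the cone of ordered configurations of a line the potential is proper and its gradient is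
  strictly monotone, so it has exactly one critical point \<open>x\<close> there. At the planar configuration
  with coordinates \<open>x\<close> on a line, the Hessian splits into a positive definite form on displacements
  along the line and the form \<open>D y y - S y y\<close> on displacements \<open>y\<close> normal to it, where
  \<open>D y y = M \<Sum>i. m i * (y i)\<^sup>2\<close> and \<open>S y y = \<Sum>i<k. m i * m k * r i k powr (- A) * (y i - y k)\<^sup>2\<close>.
  The normal form is positive on translations and vanishes on \<open>x\<close>, which spans the rotations. As
  \<open>x\<close> is a monotone eigenvector of \<open>S\<close> relative to \<open>D\<close> with eigenvalue 1, a Perron-Frobenius
  argument shows that all other eigenvalues on the hyperplane \<open>\<Sum>i. m i * y i = 0\<close> exceed 1. So the
  normal form is negative definite on this hyperplane modulo \<open>x\<close>, which has dimension \<open>N - 2\<close>.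
\<close>

section \<open>Pair energies, quadratic forms and collinear coordinates\<close>

definition pair_energy :: "real \<Rightarrow> real \<Rightarrow> real" where
  "pair_energy A r = (if A = 2 then - ln r else r powr (2 - A) / (A - 2))"

text \<open>
  Double sums below run over all ordered pairs, hence the factor 1/2; the diagonal terms vanish
  because \<open>ln 0 = 0\<close> and \<open>0 powr a = 0\<close>.
\<close>

definition potential_deriv ::
    "real \<Rightarrow> ('n::finite \<Rightarrow> real) \<Rightarrow> 'n configuration \<Rightarrow> 'n configuration \<Rightarrow> real" where
  "potential_deriv A m q v =
     total_mass m * (\<Sum>i\<in>UNIV. m i * (q $ i \<bullet> v $ i))
     - (\<Sum>i\<in>UNIV. \<Sum>k\<in>UNIV. m i * m k *
          (norm (q $ i - q $ k) powr (- A) * ((q $ i - q $ k) \<bullet> (v $ i - v $ k)))) / 2"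

text \<open>The form \<open>D\<close> above: the Hessian of the inertia term on displacements
  parallel to a fixed unit direction.\<close>

definition mass_form :: "('n::finite \<Rightarrow> real) \<Rightarrow> real ^ 'n \<Rightarrow> real ^ 'n \<Rightarrow> real" where
  "mass_form m y z = total_mass m * (\<Sum>i\<in>UNIV. m i * (y $ i * z $ i))"

text \<open>The form \<open>S\<close> above, a weighted graph Laplacian of the complete graph on the
  bodies; its kernel contains the constant vectors.\<close>

definition pair_form ::
    "real \<Rightarrow> ('n::finite \<Rightarrow> real) \<Rightarrow> real ^ 'n \<Rightarrow> real ^ 'n \<Rightarrow> real ^ 'n \<Rightarrow> real" where
  "pair_form A m x y z =
     (\<Sum>i\<in>UNIV. \<Sum>k\<in>UNIV. m i * m k *
        (\<bar>x $ i - x $ k\<bar> powr (- A) * ((y $ i - y $ k) * (z $ i - z $ k)))) / 2"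

text \<open>The weak form of the critical point equation on the line: \<open>x\<close> is an
  eigenvector, with eigenvalue 1, of the pair form relative to the mass form. The weights of the
  pair form themselves depend on \<open>x\<close>.\<close>

definition line_critical :: "real \<Rightarrow> ('n::finite \<Rightarrow> real) \<Rightarrow> real ^ 'n \<Rightarrow> bool" where
  "line_critical A m x \<longleftrightarrow> (\<forall>h. mass_form m x h = pair_form A m x x h)"

definition line_config :: "real ^ 2 \<Rightarrow> real ^ 'n \<Rightarrow> ('n::finite) configuration" where
  "line_config u x = (\<chi> i. x $ i *\<^sub>R u)"

text \<open>The quarter turn, hence both the normal direction of the line and the generator of
  rotations.\<close>

definition perp :: "real ^ 2 \<Rightarrow> real ^ 2" where
  "perp u = vector [- u $ 2, u $ 1]"

section \<open>Derivatives of the potential\<close>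

lemma sum_less_pairs:
  fixes F :: "'n::{finite,linorder} \<Rightarrow> 'n \<Rightarrow> real"
  assumes sym: "\<And>i k. F i k = F k i" and diag: "\<And>i. F i i = 0"
  shows "(\<Sum>(i, k)\<in>{(i, k). i < k}. F i k) = (\<Sum>i\<in>UNIV. \<Sum>k\<in>UNIV. F i k) / 2"
proof -
  let ?L = "{(i, k). i < k} :: ('n \<times> 'n) set" and ?G = "{(i, k). k < i} :: ('n \<times> 'n) set"
  let ?D = "{(i, k). i = k} :: ('n \<times> 'n) set"
  have "(\<Sum>i\<in>UNIV. \<Sum>k\<in>UNIV. F i k) = (\<Sum>(i, k)\<in>UNIV. F i k)"
    by (simp add: sum.cartesian_product)
  also have "(UNIV :: ('n \<times> 'n) set) = (?L \<union> ?G) \<union> ?D"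
    by auto
  also have "(\<Sum>(i, k)\<in>(?L \<union> ?G) \<union> ?D. F i k) = (\<Sum>(i, k)\<in>?L. F i k) + (\<Sum>(i, k)\<in>?G. F i k) + (\<Sum>(i, k)\<in>?D. F i k)"
    by (subst sum.union_disjoint, auto)+
  also have "(\<Sum>(i, k)\<in>?D. F i k) = 0"
    by (rule sum.neutral) (auto simp: diag)
  also have "(\<Sum>(i, k)\<in>?G. F i k) = (\<Sum>(i, k)\<in>?L. F i k)"
    by (rule sum.reindex_bij_witness[of _ prod.swap prod.swap]) (auto simp: sym)
  finally show ?thesis by simp
qed

text \<open>The case split on \<open>A\<close> is absorbed into \<open>pair_energy\<close>, and the
  order of the index type disappears from the sum.\<close>

lemma potential_eq:
  "potential A m q =
     total_mass m * (\<Sum>i\<in>UNIV. m i * (q $ i \<bullet> q $ i)) / 2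
     + (\<Sum>i\<in>UNIV. \<Sum>k\<in>UNIV. m i * m k * pair_energy A (norm (q $ i - q $ k))) / 2"
proof -
  have "(\<Sum>i\<in>UNIV. \<Sum>k\<in>UNIV. m i * m k * pair_energy A (norm (q $ i - q $ k))) / 2
     = (\<Sum>(i, k)\<in>{(i, k). i < k}. m i * m k * pair_energy A (norm (q $ i - q $ k)))"
    by (rule sum_less_pairs[symmetric]) (auto simp: norm_minus_commute pair_energy_def)
  also have "\<dots> = (if A = 2 then - (\<Sum>(i, k)\<in>{(i, k). i < k}. m i * m k * ln (norm (q $ i - q $ k)))
     else 1 / (A - 2) * (\<Sum>(i, k)\<in>{(i, k). i < k}. m i * m k * norm (q $ i - q $ k) powr (2 - A)))"
    by (simp add: pair_energy_def sum_negf case_prod_unfold sum_divide_distrib)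
  finally show ?thesis
    by (simp add: potential_def moment_of_inertia_def power2_norm_eq_inner dist_norm)
qed

text \<open>In the logarithmic and in the power case alike the radial derivative is
  \<open>- (r powr (1 - A))\<close>, so the derivative formulas are uniform in
  \<open>A\<close>.\<close>

lemma has_derivative_pair_energy:
  fixes z :: "'a::real_inner"
  assumes "z \<noteq> 0"
  shows "((\<lambda>z. pair_energy A (norm z)) has_derivative (\<lambda>h. - (norm z powr (- A) * (z \<bullet> h)))) (at z)"
proof -
  have n: "norm z > 0" using assms by simp
  have dn: "(norm has_derivative (\<lambda>h. (z \<bullet> h) / norm z)) (at z)"
    using has_derivative_norm[OF assms] by (simp add: sgn_div_norm inner_commute field_simps)
  have *: "(pair_energy A has_real_derivative - (norm z powr (1 - A))) (at (norm z))"
  proof (cases "A = 2")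
    case True
    show ?thesis unfolding pair_energy_def[abs_def] using n True
      by (auto intro!: derivative_eq_intros simp: powr_minus field_simps)
  next
    case False
    have "((\<lambda>r. r powr (2 - A) / (A - 2)) has_real_derivative (2 - A) * norm z powr (2 - A - 1) / (A - 2)) (at (norm z))"
      using n by (intro DERIV_cdivide) (auto intro!: derivative_eq_intros)
    moreover have "(2 - A) * norm z powr (2 - A - 1) / (A - 2) = - (norm z powr (1 - A))"
      using False by (simp add: divide_eq_eq algebra_simps)
    ultimately show ?thesis using False by (simp add: pair_energy_def[abs_def])
  qed
  have "((\<lambda>z. pair_energy A (norm z)) has_derivative (\<lambda>h. - (norm z powr (1 - A)) * ((z \<bullet> h) / norm z))) (at z)"
    using has_derivative_compose[OF dn, of "pair_energy A" "(*) (- (norm z powr (1 - A)))"] *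
    by (simp add: has_field_derivative_def)
  moreover have "norm z powr (1 - A) = norm z * norm z powr (- A)"
    using n by (simp add: powr_diff powr_minus field_simps)
  ultimately show ?thesis using n by simp
qed

lemma has_derivative_pair_force:
  fixes z :: "'a::real_inner"
  assumes "z \<noteq> 0"
  shows "((\<lambda>z. norm z powr (- A) * (z \<bullet> a)) has_derivative
     (\<lambda>h. norm z powr (- A) * (h \<bullet> a) - A * norm z powr (- A - 2) * (z \<bullet> h) * (z \<bullet> a))) (at z)"
proof -
  have n: "norm z > 0" using assms by simp
  have dn: "(norm has_derivative (\<lambda>h. (z \<bullet> h) / norm z)) (at z)"
    using has_derivative_norm[OF assms] by (simp add: sgn_div_norm inner_commute field_simps)
  have *: "((\<lambda>r. r powr (- A)) has_real_derivative - A * norm z powr (- A - 1)) (at (norm z))"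
    using n by (auto intro!: derivative_eq_intros)
  have d: "((\<lambda>z. norm z powr (- A)) has_derivative (\<lambda>h. - A * norm z powr (- A - 1) * ((z \<bullet> h) / norm z))) (at z)"
    using has_derivative_compose[OF dn, of "\<lambda>r. r powr (- A)" "(*) (- A * norm z powr (- A - 1))"] *
    by (simp add: has_field_derivative_def)
  have "norm z powr (- A - 1) = norm z * norm z powr (- A - 2)"
    using n by (simp add: powr_diff powr_minus field_simps power2_eq_square)
  then have d': "((\<lambda>z. norm z powr (- A)) has_derivative (\<lambda>h. - A * norm z powr (- A - 2) * (z \<bullet> h))) (at z)"
    using d n by (simp add: mult.assoc)
  show ?thesis
    by (rule has_derivative_eq_rhs[OF has_derivative_mult[OF d' has_derivative_inner_left[OF has_derivative_ident]]])
      (auto simp: algebra_simps)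
qed

lemma has_derivative_diff_component:
  "((\<lambda>q. q $ i - q $ k) has_derivative (\<lambda>v. v $ i - v $ k)) (at (q :: 'n::finite configuration))"
  by (intro derivative_intros bounded_linear_imp_has_derivative bounded_linear_vec_nth)

lemma has_derivative_potential:
  fixes q :: "'n::{finite,linorder} configuration"
  assumes q: "q \<notin> collision_set"
  shows "(potential A m has_derivative potential_deriv A m q) (at q)"
proof -
  have 1: "((\<lambda>q. pair_energy A (norm (q $ i - q $ k))) has_derivative
     (\<lambda>v. - (norm (q $ i - q $ k) powr (- A) * ((q $ i - q $ k) \<bullet> (v $ i - v $ k))))) (at q)" for i k
  \<comment> \<open>On the diagonal the function is constant, so the singularity of the norm at 0
    does not enter.\<close>
  proof (cases "i = k")
    case False
    then have "q $ i - q $ k \<noteq> 0" using q by (auto simp: collision_set_def)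
    from has_derivative_compose[OF has_derivative_diff_component has_derivative_pair_energy[OF this]]
    show ?thesis .
  qed simp
  have c: "((\<lambda>q. q $ i) has_derivative (\<lambda>v. v $ i)) (at q)" for i
    by (intro bounded_linear_imp_has_derivative bounded_linear_vec_nth)
  have 2: "((\<lambda>q. q $ i \<bullet> q $ i) has_derivative (\<lambda>v. 2 * (q $ i \<bullet> v $ i))) (at q)" for i
    by (rule has_derivative_eq_rhs[OF has_derivative_inner[OF c c]]) (auto simp: inner_commute)
  have "((\<lambda>q. total_mass m * (\<Sum>i\<in>UNIV. m i * (q $ i \<bullet> q $ i)) / 2
     + (\<Sum>i\<in>UNIV. \<Sum>k\<in>UNIV. m i * m k * pair_energy A (norm (q $ i - q $ k))) / 2) has_derivative
     (\<lambda>v. total_mass m * (\<Sum>i\<in>UNIV. m i * (2 * (q $ i \<bullet> v $ i))) / 2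
     + (\<Sum>i\<in>UNIV. \<Sum>k\<in>UNIV. m i * m k * - (norm (q $ i - q $ k) powr (- A) * ((q $ i - q $ k) \<bullet> (v $ i - v $ k)))) / 2)) (at q)"
    unfolding divide_inverse
    by (intro has_derivative_add has_derivative_mult_left has_derivative_mult_right has_derivative_sum 1 2)
  then show ?thesis
    unfolding potential_eq[abs_def]
    by (rule has_derivative_eq_rhs)
      (simp add: fun_eq_iff potential_deriv_def sum_negf sum_distrib_left[symmetric] mult.left_commute[of _ 2])
qed

lemma open_noncollision: "open (- collision_set :: 'n::finite configuration set)"
proof -
  have "open {q :: 'n configuration. q $ i \<noteq> q $ k}" for i k
    by (intro open_Collect_neq continuous_intros)
  then have "open (\<Inter>(i, k)\<in>{(i, k). i \<noteq> k}. {q :: 'n configuration. q $ i \<noteq> q $ k})"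
    by (intro open_INT) auto
  also have "(\<Inter>(i, k)\<in>{(i, k). i \<noteq> k}. {q :: 'n configuration. q $ i \<noteq> q $ k}) = - collision_set"
    by (auto simp: collision_set_def)
  finally show ?thesis .
qed

lemma hessian_potential:
  fixes q :: "'n::{finite,linorder} configuration"
  assumes q: "q \<notin> collision_set"
  shows "hessian (potential A m) q v w =
     total_mass m * (\<Sum>i\<in>UNIV. m i * (v $ i \<bullet> w $ i))
     - (\<Sum>i\<in>UNIV. \<Sum>k\<in>UNIV. m i * m k *
          (norm (q $ i - q $ k) powr (- A) * ((w $ i - w $ k) \<bullet> (v $ i - v $ k))
           - A * norm (q $ i - q $ k) powr (- A - 2) * ((q $ i - q $ k) \<bullet> (w $ i - w $ k))
             * ((q $ i - q $ k) \<bullet> (v $ i - v $ k)))) / 2"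
    (is "_ = ?H w")
proof -
  have 1: "((\<lambda>q. norm (q $ i - q $ k) powr (- A) * ((q $ i - q $ k) \<bullet> (v $ i - v $ k))) has_derivative
     (\<lambda>w. norm (q $ i - q $ k) powr (- A) * ((w $ i - w $ k) \<bullet> (v $ i - v $ k))
           - A * norm (q $ i - q $ k) powr (- A - 2) * ((q $ i - q $ k) \<bullet> (w $ i - w $ k))
             * ((q $ i - q $ k) \<bullet> (v $ i - v $ k)))) (at q)" for i k
  proof (cases "i = k")
    case False
    then have "q $ i - q $ k \<noteq> 0" using q by (auto simp: collision_set_def)
    from has_derivative_compose[OF has_derivative_diff_component has_derivative_pair_force[OF this]]
    show ?thesis .
  qed simp
  have c: "((\<lambda>q. q $ i) has_derivative (\<lambda>v. v $ i)) (at q)" for i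
    by (intro bounded_linear_imp_has_derivative bounded_linear_vec_nth)
  have 2: "((\<lambda>q. q $ i \<bullet> v $ i) has_derivative (\<lambda>w. v $ i \<bullet> w $ i)) (at q)" for i
    by (rule has_derivative_eq_rhs[OF has_derivative_inner_left[OF c]]) (auto simp: inner_commute)
  have "((\<lambda>q. potential_deriv A m q v) has_derivative ?H) (at q)"
    unfolding potential_deriv_def divide_inverse
    by (intro has_derivative_diff has_derivative_mult_left has_derivative_mult_right has_derivative_sum 1 2)
  \<comment> \<open>\<open>potential_deriv\<close> is known to be the derivative only off
    collisions; as these configurations form an open set, the two functions agree near
    \<open>q\<close>.\<close>
  then have "((\<lambda>x. frechet_derivative (potential A m) (at x) v) has_derivative ?H) (at q)"
    by (rule has_derivative_transform_within_open[OF _ open_noncollision])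
      (use q in \<open>auto simp: frechet_derivative_at[OF has_derivative_potential, symmetric]\<close>)
  from frechet_derivative_at[OF this, symmetric] show ?thesis
    unfolding hessian_def by (rule fun_cong)
qed

lemma central_configuration_iff:
  "central_configuration A m q \<longleftrightarrow> q \<notin> collision_set \<and> (\<forall>v. potential_deriv A m q v = 0)"
proof -
  have "(potential A m has_derivative (\<lambda>v. 0)) (at q) \<longleftrightarrow> (\<forall>v. potential_deriv A m q v = 0)"
    if "q \<notin> collision_set"
  proof
    assume "(potential A m has_derivative (\<lambda>v. 0)) (at q)"
    from has_derivative_unique[OF has_derivative_potential[OF that] this]
    show "\<forall>v. potential_deriv A m q v = 0" by simp
  next
    assume "\<forall>v. potential_deriv A m q v = 0"
    then have "potential_deriv A m q = (\<lambda>v. 0)" by blast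
    then show "(potential A m has_derivative (\<lambda>v. 0)) (at q)"
      using has_derivative_potential[OF that, of A m] by simp
  qed
  then show ?thesis by (auto simp: central_configuration_def)
qed

section \<open>Quadratic forms\<close>

text \<open>If \<open>B y z\<close> were nonzero, a suitable step from the null vector
  \<open>y\<close> along \<open>z\<close> would make the form negative.\<close>

lemma semidefinite_kernel:
  fixes B :: "'a::euclidean_space \<Rightarrow> 'a \<Rightarrow> real"
  assumes B: "bilinear B" and sym: "\<And>v w. B v w = B w v" and V: "subspace V"
    and nonneg: "\<And>v. v \<in> V \<Longrightarrow> B v v \<ge> 0"
    and y: "y \<in> V" "B y y = 0" and z: "z \<in> V"
  shows "B y z = 0"
proof (rule ccontr)
  assume b: "B y z \<noteq> 0"
  define c where "c = B z z"
  have c: "c \<ge> 0" using nonneg z c_def by auto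
  \<comment> \<open>With this step the form at \<open>y + t *\<^sub>R z\<close> is
    \<open>- (t\<^sup>2 * (c + 2))\<close>; the summand 1 keeps the denominator positive when
    \<open>c = 0\<close>.\<close>
  define t where "t = - B y z / (c + 1)"
  have t: "B y z = - t * (c + 1)" using c by (simp add: t_def)
  have "y + t *\<^sub>R z \<in> V" by (simp add: V y z subspace_add subspace_scale)
  then have "0 \<le> B (y + t *\<^sub>R z) (y + t *\<^sub>R z)" by (rule nonneg)
  also have "\<dots> = 2 * t * B y z + t\<^sup>2 * c"
    by (simp add: bilinear_ladd[OF B] bilinear_radd[OF B] bilinear_lmul[OF B] bilinear_rmul[OF B]
        y sym[of z y] c_def power2_eq_square algebra_simps)
  also have "\<dots> = - (t\<^sup>2 * (c + 2))"
    unfolding t by (simp add: algebra_simps power2_eq_square)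
  also have "\<dots> < 0" using b c t by (auto intro!: mult_pos_pos)
  finally show False by simp
qed

text \<open>The quotient \<open>S z z / D z z\<close> is invariant under scaling, so its minimum
  over the compact unit sphere of \<open>V\<close> is its minimum over all nonzero vectors of
  \<open>V\<close>.\<close>

lemma rayleigh_minimum:
  fixes S D :: "'a::euclidean_space \<Rightarrow> 'a \<Rightarrow> real"
  assumes S: "bilinear S" and D: "bilinear D" and V: "subspace V" "V \<noteq> {0}"
    and pos: "\<And>v. v \<noteq> 0 \<Longrightarrow> D v v > 0"
  shows "\<exists>l y. y \<in> V \<and> y \<noteq> 0 \<and> S y y = l * D y y \<and> (\<forall>z\<in>V. l * D z z \<le> S z z)"
proof -
  let ?K = "V \<inter> sphere 0 1"
  have cont: "continuous_on X (\<lambda>z. B z z)" if "bilinear B" for B :: "'a \<Rightarrow> 'a \<Rightarrow> real" and X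
    using that bilinear_continuous_on_compose[OF continuous_on_id continuous_on_id] by fastforce
  have "compact ?K" by (simp add: V closed_Int_compact closed_subspace)
  moreover obtain v where "v \<in> V" "v \<noteq> 0" using V subspace_0[OF V(1)] by blast
  then have "(1 / norm v) *\<^sub>R v \<in> ?K" by (simp add: subspace_scale[OF V(1)])
  then have "?K \<noteq> {}" by blast
  moreover have "continuous_on ?K (\<lambda>z. S z z / D z z)"
  proof (intro continuous_on_divide cont[OF S] cont[OF D] ballI)
    fix z assume "z \<in> ?K"
    then have "z \<noteq> 0" by auto
    then show "D z z \<noteq> 0" using pos by (metis less_irrefl)
  qed
  ultimately obtain y where y: "y \<in> ?K" "\<And>z. z \<in> ?K \<Longrightarrow> S y y / D y y \<le> S z z / D z z"
    using continuous_attains_inf[of ?K "\<lambda>z. S z z / D z z"] by metis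
  have y0: "y \<noteq> 0" using y by auto
  show ?thesis
  proof (intro exI conjI ballI)
    show "y \<in> V" "y \<noteq> 0" using y y0 by auto
    show "S y y = S y y / D y y * D y y" using pos[OF y0] by simp
    show "S y y / D y y * D z z \<le> S z z" if "z \<in> V" for z
    proof (cases "z = 0")
      case True
      then show ?thesis by (simp add: bilinear_lzero[OF S] bilinear_lzero[OF D])
    next
      case False
      have "(1 / norm z) *\<^sub>R z \<in> ?K" using that False by (simp add: subspace_scale[OF V(1)])
      from y(2)[OF this] have "S y y / D y y \<le> S z z / D z z"
        using False by (simp add: bilinear_lmul[OF S] bilinear_rmul[OF S] bilinear_lmul[OF D] bilinear_rmul[OF D])
      then show ?thesis using pos[OF False] by (simp add: field_simps)
    qed
  qed
qed

section \<open>The mass form and the pair form\<close>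

lemma mass_form_sym: "mass_form m y z = mass_form m z y"
  by (simp add: mass_form_def mult.commute)

lemma pair_form_sym: "pair_form A m x y z = pair_form A m x z y"
  by (simp add: pair_form_def mult.commute)

lemma bilinear_mass_form: "bilinear (mass_form m)"
proof -
  have "linear (mass_form m y)" for y
  proof (rule linearI)
    show "mass_form m y (z + z') = mass_form m y z + mass_form m y z'" for z z'
      by (simp add: mass_form_def distrib_left sum.distrib)
    show "mass_form m y (c *\<^sub>R z) = c *\<^sub>R mass_form m y z" for c z
      by (simp add: mass_form_def sum_distrib_left mult_ac)
  qed
  moreover have "mass_form m y z = mass_form m z y" for y z by (rule mass_form_sym)
  ultimately show ?thesis unfolding bilinear_def by presburger
qed

lemma bilinear_pair_form: "bilinear (pair_form A m x)"
proof -
  have "linear (pair_form A m x y)" for y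
  proof (rule linearI)
    have *: "z $ i + z' $ i - (z $ k + z' $ k) = (z $ i - z $ k) + (z' $ i - z' $ k)" for z z' :: "real ^ 'a" and i k
      by simp
    show "pair_form A m x y (z + z') = pair_form A m x y z + pair_form A m x y z'" for z z'
      by (simp add: pair_form_def * distrib_left sum.distrib add_divide_distrib)
    show "pair_form A m x y (c *\<^sub>R z) = c *\<^sub>R pair_form A m x y z" for c z
      by (simp add: pair_form_def sum_distrib_left right_diff_distrib[symmetric] mult_ac)
  qed
  moreover have "pair_form A m x y z = pair_form A m x z y" for y z by (rule pair_form_sym)
  ultimately show ?thesis unfolding bilinear_def by presburger
qed

lemma pair_form_nonneg:
  assumes "\<And>i. m i > 0"
  shows "pair_form A m x y y \<ge> 0"
  unfolding pair_form_def
  by (intro divide_nonneg_pos sum_nonneg mult_nonneg_nonneg powr_ge_zero zero_le_square less_imp_le[OF assms]) simp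

lemma total_mass_pos:
  assumes "\<And>i. m i > 0" shows "total_mass m > 0"
  unfolding total_mass_def by (rule sum_pos) (auto simp: assms)

lemma mass_form_pos:
  assumes m: "\<And>i. m i > 0" and "y \<noteq> 0"
  shows "mass_form m y y > 0"
proof -
  obtain j where "y $ j \<noteq> 0" using assms(2) by (auto simp: vec_eq_iff)
  then have "0 < m j * (y $ j * y $ j)" using m by (auto simp: zero_less_mult_iff)
  then have "0 < (\<Sum>i\<in>UNIV. m i * (y $ i * y $ i))"
    by (intro sum_pos2[of _ j]) (auto simp: m less_imp_le)
  then show ?thesis using total_mass_pos[of m] m by (simp add: mass_form_def)
qed

text \<open>Testing with a unit vector extracts the equation of body \<open>j\<close>. The factor
  1/2 cancels because \<open>j\<close> occurs as first and as second index of a pair.\<close>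

lemma pair_form_axis:
  "pair_form A m x y (axis j 1) = (\<Sum>k\<in>UNIV. m j * m k * (\<bar>x $ j - x $ k\<bar> powr (- A) * (y $ j - y $ k)))"
proof -
  let ?w = "\<lambda>i k. m i * m k * (\<bar>x $ i - x $ k\<bar> powr (- A) * (y $ i - y $ k))"
  have "(\<Sum>i\<in>UNIV. \<Sum>k\<in>UNIV. m i * m k *
        (\<bar>x $ i - x $ k\<bar> powr (- A) * ((y $ i - y $ k) * (axis j 1 $ i - axis j 1 $ k))))
      = (\<Sum>i\<in>UNIV. \<Sum>k\<in>UNIV. (if i = j then ?w i k else 0)) - (\<Sum>i\<in>UNIV. \<Sum>k\<in>UNIV. (if k = j then ?w i k else 0))"
    unfolding sum_subtractf[symmetric] by (intro sum.cong refl) (auto simp: axis_def algebra_simps)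
  also have "(\<Sum>i\<in>UNIV. \<Sum>k\<in>UNIV. (if i = j then ?w i k else 0)) = (\<Sum>k\<in>UNIV. ?w j k)"
    by (subst sum.swap) (simp)
  also have "(\<Sum>i\<in>UNIV. \<Sum>k\<in>UNIV. (if k = j then ?w i k else 0)) = (\<Sum>i\<in>UNIV. - ?w j i)"
    by (simp, intro sum.cong refl) (simp add: abs_minus_commute algebra_simps)
  finally show ?thesis by (simp add: pair_form_def sum_negf)
qed

lemma mass_form_axis: "mass_form m y (axis j 1) = total_mass m * (m j * y $ j)"
proof -
  have "(\<Sum>i\<in>UNIV. m i * (y $ i * axis j 1 $ i)) = (\<Sum>i\<in>UNIV. if i = j then m i * y $ i else 0)"
    by (intro sum.cong) (auto simp: axis_def)
  then show ?thesis by (simp add: mass_form_def)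
qed

section \<open>The spectral gap of a collinear central configuration\<close>

text \<open>
  A Perron-Frobenius argument: \<open>y - S x\<close> is antitone along the line and takes equal values at
  \<open>a\<close> and \<open>b\<close>, so in the difference of the two eigenvalue equations at \<open>a\<close> and \<open>b\<close> every
  summand is nonnegative.
\<close>

lemma maximal_slope_eigenvalue:
  fixes x y :: "real ^ 'n::finite"
  assumes A: "A > 0" and m: "\<And>i. m i > 0" and M: "M > 0"
    and x: "\<And>j. (\<Sum>k\<in>UNIV. m k * (\<bar>x $ j - x $ k\<bar> powr (- A) * (x $ j - x $ k))) = M * x $ j"
    and y: "\<And>j. (\<Sum>k\<in>UNIV. m k * (\<bar>x $ j - x $ k\<bar> powr (- A) * (y $ j - y $ k))) = l * (M * y $ j)"
    and ab: "x $ a < x $ b" "y $ b - y $ a = S * (x $ b - x $ a)" and S: "S > 0"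
    and slope: "\<And>i k. x $ i \<le> x $ k \<Longrightarrow> y $ k - y $ i \<le> S * (x $ k - x $ i)"
  shows "l \<ge> 1 \<and> (l = 1 \<longrightarrow> (\<forall>k. y $ k - y $ a = S * (x $ k - x $ a)))"
proof -
  define u where "u k = y $ k - S * x $ k" for k
  define r where "r j k = \<bar>x $ j - x $ k\<bar> powr (- A)" for j k
  define T where "T k = m k * ((u a - u k) * (r b k - r a k))" for k
  have anti: "u k \<le> u i" if "x $ i \<le> x $ k" for i k
    using slope[OF that] by (simp add: u_def algebra_simps)
  have uab: "u b = u a" using ab(2) by (simp add: u_def algebra_simps)
  have between: "u k = u a" if "x $ a \<le> x $ k" "x $ k \<le> x $ b" for k
    using anti[OF that(1)] anti[OF that(2)] uab by simp
  \<comment> \<open>The condition \<open>x $ i \<noteq> x $ k\<close> keeps out the value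
    \<open>0 powr (- A) = 0\<close>, at which the power is not decreasing.\<close>
  have r_less: "r j k < r i k" if "x $ i \<noteq> x $ k" "\<bar>x $ i - x $ k\<bar> < \<bar>x $ j - x $ k\<bar>" for i j k
    unfolding r_def using that A by (intro powr_less_mono2_neg) auto
  \<comment> \<open>Left of \<open>a\<close> both factors of \<open>T k\<close> are at most 0, right
    of \<open>b\<close> both are at least 0, and in between the factor \<open>u a - u k\<close>
    vanishes.\<close>
  have left: "u a \<le> u k \<and> r b k < r a k" if "x $ k < x $ a" for k
    using that ab anti[of k a] by (auto intro!: r_less)
  have right: "u k \<le> u a \<and> r a k < r b k" if "x $ b < x $ k" for k
    using that ab anti[of b k] uab by (auto intro!: r_less)
  have T_nonneg: "T k \<ge> 0" for k
  proof -
    consider "x $ k < x $ a" | "x $ b < x $ k" | "x $ a \<le> x $ k" "x $ k \<le> x $ b" by linarith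
    then have "(u a - u k) * (r b k - r a k) \<ge> 0"
      using left[of k] right[of k] between[of k] by cases (auto intro: mult_nonneg_nonneg mult_nonpos_nonpos)
    then show ?thesis using m[of k] by (simp add: T_def)
  qed
  have U: "(\<Sum>k\<in>UNIV. m k * (r j k * (u j - u k))) = l * (M * y $ j) - S * (M * x $ j)" for j
    unfolding x[symmetric] y[symmetric] sum_distrib_left sum_subtractf[symmetric]
    by (intro sum.cong refl) (simp add: u_def r_def algebra_simps)
  have "(\<Sum>k\<in>UNIV. T k) = (\<Sum>k\<in>UNIV. m k * (r b k * (u b - u k))) - (\<Sum>k\<in>UNIV. m k * (r a k * (u a - u k)))"
    unfolding sum_subtractf[symmetric] by (intro sum.cong refl) (simp add: T_def uab algebra_simps)
  also have "\<dots> = l * M * (y $ b - y $ a) - S * M * (x $ b - x $ a)"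
    unfolding U by (simp add: algebra_simps)
  also have "\<dots> = (l - 1) * (M * S * (x $ b - x $ a))"
    unfolding ab by (simp add: algebra_simps)
  finally have sum_T: "(\<Sum>k\<in>UNIV. T k) = (l - 1) * (M * S * (x $ b - x $ a))" .
  have P: "M * S * (x $ b - x $ a) > 0" using M S ab by simp
  have "(l - 1) * (M * S * (x $ b - x $ a)) \<ge> 0"
    unfolding sum_T[symmetric] by (intro sum_nonneg T_nonneg)
  then have "l \<ge> 1" using P by (simp add: zero_le_mult_iff)
  \<comment> \<open>For \<open>l = 1\<close> the nonnegative \<open>T k\<close> sum to 0, so each
    vanishes; the strict comparison of weights outside the interval from \<open>a\<close> to
    \<open>b\<close> then forces \<open>u k = u a\<close>.\<close>
  moreover have "y $ k - y $ a = S * (x $ k - x $ a)" if "l = 1" for k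
  proof -
    have "T k = 0" using sum_T that sum_nonneg_eq_0_iff[of UNIV T] T_nonneg by simp
    then have "u k = u a \<or> r b k = r a k" using m[of k] by (auto simp: T_def)
    then have "u k = u a" using left[of k] right[of k] between[of k] by force
    then show ?thesis by (simp add: u_def algebra_simps)
  qed
  ultimately show ?thesis by blast
qed

text \<open>Testing with a uniform translation, which the pair form annihilates, leaves only the
  mass term.\<close>

lemma line_critical_barycenter:
  assumes "line_critical A m x" and m: "\<And>i. m i > 0"
  shows "(\<Sum>i\<in>UNIV. m i * x $ i) = 0"
  using assms(1)[unfolded line_critical_def, rule_format, of "\<chi> i. 1"] total_mass_pos[of m] m
  by (auto simp: mass_form_def pair_form_def)

text \<open>A centred nonzero \<open>y\<close> is not constant, so up to sign it has a positive
  maximal slope \<open>S\<close> relative to \<open>x\<close>, and the slope comparison applies. If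
  \<open>l = 1\<close>, then \<open>y\<close> is affine in \<open>x\<close>; as both are centred,
  the constant term vanishes.\<close>

lemma eigenvalue_ge_1:
  fixes x y :: "real ^ 'n::finite"
  assumes crit: "line_critical A m x" and A: "A > 0" and m: "\<And>i. m i > 0"
    and inj: "inj (($) x)"
    and y: "y \<noteq> 0" "(\<Sum>i\<in>UNIV. m i * y $ i) = 0"
    and eig: "\<And>z. pair_form A m x y z = l * mass_form m y z"
  shows "l \<ge> 1 \<and> (l = 1 \<longrightarrow> y \<in> span {x})"
proof -
  let ?M = "total_mass m"
  have M: "?M > 0" by (rule total_mass_pos) (rule m)
  \<comment> \<open>Testing with a unit vector and dividing by \<open>m j\<close> gives the
    eigenvalue equation body by body.\<close>
  have cancel: "(\<Sum>k\<in>UNIV. m k * (\<bar>x $ j - x $ k\<bar> powr (- A) * (z $ j - z $ k))) = c * (?M * z $ j)"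
    if "pair_form A m x z (axis j 1) = c * mass_form m z (axis j 1)" for z c j
  proof -
    have "m j * (\<Sum>k\<in>UNIV. m k * (\<bar>x $ j - x $ k\<bar> powr (- A) * (z $ j - z $ k))) = m j * (c * (?M * z $ j))"
      using that by (simp add: pair_form_axis mass_form_axis sum_distrib_left mult_ac)
    then show ?thesis using m[of j] by simp
  qed
  have x_eig: "(\<Sum>k\<in>UNIV. m k * (\<bar>x $ j - x $ k\<bar> powr (- A) * (x $ j - x $ k))) = ?M * x $ j" for j
    using cancel[of x j 1] crit by (simp add: line_critical_def)
  obtain i k where ik: "y $ i \<noteq> y $ k" "x $ i < x $ k"
  proof -
    have "\<exists>i k. y $ i \<noteq> y $ k"
    proof (rule ccontr)
      assume "\<not> (\<exists>i k. y $ i \<noteq> y $ k)"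
      then have c: "y $ i = y $ undefined" for i by blast
      then have "(\<Sum>i\<in>UNIV. m i * y $ i) = ?M * y $ undefined"
        unfolding total_mass_def sum_distrib_right by (metis (no_types, lifting) sum.cong)
      then have "y $ undefined = 0" using y M by simp
      then have "y = 0" using c by (simp add: vec_eq_iff)
      then show False using y by simp
    qed
    then obtain i k where ik: "y $ i \<noteq> y $ k" by blast
    then have "x $ i \<noteq> x $ k" using inj by (auto dest: injD)
    then show thesis using that[of i k] that[of k i] ik by (cases "x $ i < x $ k") auto
  qed
  \<comment> \<open>The sign makes \<open>w\<close> increase from \<open>i\<close> to
    \<open>k\<close>, so the maximal slope is positive.\<close>
  define s :: real where "s = sgn (y $ k - y $ i)"
  define w where "w = s *\<^sub>R y"
  have w_eig: "(\<Sum>k\<in>UNIV. m k * (\<bar>x $ j - x $ k\<bar> powr (- A) * (w $ j - w $ k))) = l * (?M * w $ j)" for j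
    by (rule cancel)
      (simp add: w_def eig bilinear_lmul[OF bilinear_pair_form] bilinear_lmul[OF bilinear_mass_form])
  let ?P = "{(a, b). x $ a < x $ b}"
  let ?slope = "\<lambda>(a, b). (w $ b - w $ a) / (x $ b - x $ a)"
  define S where "S = Max (?slope ` ?P)"
  have ikP: "(i, k) \<in> ?P" using ik by simp
  have "S \<in> ?slope ` ?P" unfolding S_def using ikP by (intro Max_in) auto
  then obtain a b where ab: "x $ a < x $ b" "S = (w $ b - w $ a) / (x $ b - x $ a)" by auto
  have le: "?slope p \<le> S" if "p \<in> ?P" for p
    unfolding S_def using that by (intro Max_ge) auto
  have "w $ k - w $ i = \<bar>y $ k - y $ i\<bar>"
    by (simp add: w_def s_def abs_sgn algebra_simps)
  then have "?slope (i, k) > 0" using ik by simp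
  then have S: "S > 0" using le[OF ikP] by linarith
  have "w $ q - w $ p \<le> S * (x $ q - x $ p)" if "x $ p \<le> x $ q" for p q
  proof (cases "p = q")
    case False
    then have "x $ p < x $ q" using that inj by (auto simp: less_le dest: injD)
    then show ?thesis using le[of "(p, q)"] by (simp add: pos_divide_le_eq)
  qed simp
  then have main: "l \<ge> 1 \<and> (l = 1 \<longrightarrow> (\<forall>k. w $ k - w $ a = S * (x $ k - x $ a)))"
    using ab by (intro maximal_slope_eigenvalue[OF A m M x_eig w_eig ab(1) _ S]) auto
  have "y \<in> span {x}" if "l = 1"
  proof -
    have e: "w $ k = S * x $ k + (w $ a - S * x $ a)" for k
      using main that by (auto simp: algebra_simps)
    have "s * (\<Sum>k\<in>UNIV. m k * y $ k) = (\<Sum>k\<in>UNIV. m k * w $ k)"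
      by (simp add: w_def sum_distrib_left mult_ac)
    also have "\<dots> = S * (\<Sum>k\<in>UNIV. m k * x $ k) + ?M * (w $ a - S * x $ a)"
      by (subst e) (simp add: total_mass_def sum_distrib_left sum_distrib_right distrib_left sum.distrib mult_ac)
    finally have z: "w $ a - S * x $ a = 0"
      using y M line_critical_barycenter[OF crit m] by simp
    have "w $ k = S * x $ k" for k using e[of k] z by linarith
    then have "w = S *\<^sub>R x" by (simp add: vec_eq_iff)
    moreover have "y = s *\<^sub>R w" using ik by (simp add: w_def s_def sgn_if)
    ultimately show ?thesis by (simp add: span_base span_scale)
  qed
  then show ?thesis using main by blast
qed

text \<open>A minimiser of the Rayleigh quotient on the centred hyperplane is an eigenvector, so the
  minimum is at least 1. Equality at \<open>y\<close> would make \<open>y\<close> itself a minimiser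
  with eigenvalue 1, hence a multiple of \<open>x\<close>.\<close>

lemma pair_form_gt_mass_form:
  fixes x y :: "real ^ 'n::finite"
  assumes crit: "line_critical A m x" and A: "A > 0" and m: "\<And>i. m i > 0"
    and inj: "inj (($) x)"
    and y: "(\<Sum>i\<in>UNIV. m i * y $ i) = 0" "y \<notin> span {x}"
  shows "mass_form m y y < pair_form A m x y y"
proof -
  let ?M = "total_mass m"
  have M: "?M > 0" by (rule total_mass_pos) (rule m)
  define V where "V = {z :: real ^ 'n. (\<Sum>i\<in>UNIV. m i * z $ i) = 0}"
  have V: "subspace V"
    by (rule subspaceI)
      (auto simp: V_def distrib_left sum.distrib mult.left_commute[of _ _ "_ $ _"] sum_distrib_left[symmetric])
  \<comment> \<open>A minimiser lies in the kernel of the semidefinite form \<open>?B\<close> on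
    \<open>V\<close>. The equation extends from \<open>V\<close> to all \<open>z\<close> because
    translations are annihilated by the pair form and orthogonal to \<open>V\<close> for the mass
    form.\<close>
  have eigen: "pair_form A m x v z = l * mass_form m v z"
    if nn: "\<forall>z\<in>V. l * mass_form m z z \<le> pair_form A m x z z"
      and v: "v \<in> V" "pair_form A m x v v = l * mass_form m v v" for l v z
  proof -
    let ?B = "\<lambda>v w. pair_form A m x v w - l * mass_form m v w"
    have B: "bilinear ?B"
      unfolding bilinear_def
      by (auto intro!: linearI simp: bilinear_ladd[OF bilinear_pair_form] bilinear_ladd[OF bilinear_mass_form]
          bilinear_radd[OF bilinear_pair_form] bilinear_radd[OF bilinear_mass_form]
          bilinear_lmul[OF bilinear_pair_form] bilinear_lmul[OF bilinear_mass_form]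
          bilinear_rmul[OF bilinear_pair_form] bilinear_rmul[OF bilinear_mass_form] algebra_simps)
    define c where "c = (\<Sum>i\<in>UNIV. m i * z $ i) / ?M"
    define z' where "z' = z - (\<chi> i. c)"
    have "(\<Sum>i\<in>UNIV. m i * z' $ i) = (\<Sum>i\<in>UNIV. m i * z $ i) - ?M * c"
      by (simp add: z'_def right_diff_distrib sum_subtractf total_mass_def sum_distrib_right)
    then have "z' \<in> V" using M by (simp add: V_def c_def)
    have "?B v z' = 0"
    proof (rule semidefinite_kernel[OF B _ V])
      show "?B v w = ?B w v" for v w
        using pair_form_sym[of A m x v w] mass_form_sym[of m v w] by simp
      show "?B z z \<ge> 0" if "z \<in> V" for z using nn that by simp
      show "v \<in> V" "?B v v = 0" "z' \<in> V" using v \<open>z' \<in> V\<close> by simp_all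
    qed
    moreover have "pair_form A m x v z' = pair_form A m x v z"
      by (simp add: pair_form_def z'_def)
    moreover have "(\<Sum>i\<in>UNIV. m i * (v $ i * z' $ i)) = (\<Sum>i\<in>UNIV. m i * (v $ i * z $ i)) - c * (\<Sum>i\<in>UNIV. m i * v $ i)"
      by (simp add: z'_def right_diff_distrib sum_subtractf sum_distrib_left mult_ac)
    then have "mass_form m v z' = mass_form m v z"
      using v by (simp add: mass_form_def V_def)
    ultimately show ?thesis by simp
  qed
  have yV: "y \<in> V" "y \<noteq> 0" using y by (auto simp: V_def span_zero)
  then have V0: "V \<noteq> {0}" by blast
  have "\<exists>l v. v \<in> V \<and> v \<noteq> 0 \<and> pair_form A m x v v = l * mass_form m v v \<and>
      (\<forall>z\<in>V. l * mass_form m z z \<le> pair_form A m x z z)"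
    by (rule rayleigh_minimum[OF bilinear_pair_form bilinear_mass_form V V0]) (rule mass_form_pos[OF m])
  then obtain l v where v: "v \<in> V" "v \<noteq> 0" "pair_form A m x v v = l * mass_form m v v"
    and l: "\<forall>z\<in>V. l * mass_form m z z \<le> pair_form A m x z z" by (elim exE conjE)
  have l1: "l \<ge> 1"
    using eigenvalue_ge_1[OF crit A m inj v(2) _ eigen[OF l v(1,3)]] v(1) by (simp add: V_def)
  have semi: "\<forall>z\<in>V. 1 * mass_form m z z \<le> pair_form A m x z z"
  proof
    fix z assume "z \<in> V"
    have "mass_form m z z \<ge> 0"
      using mass_form_pos[of m z] m by (cases "z = 0") (auto simp: mass_form_def)
    then have "1 * mass_form m z z \<le> l * mass_form m z z" using l1 by (intro mult_right_mono) auto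
    then show "1 * mass_form m z z \<le> pair_form A m x z z" using l \<open>z \<in> V\<close> by fastforce
  qed
  have "pair_form A m x y y \<noteq> 1 * mass_form m y y"
    using eigenvalue_ge_1[OF crit A m inj yV(2) y(1) eigen[OF semi yV(1)]] y(2) by blast
  then show ?thesis using semi yV(1) by fastforce
qed

section \<open>Collinear central configurations\<close>

lemma line_config_nth [simp]: "line_config u x $ i = x $ i *\<^sub>R u"
  by (simp add: line_config_def)

lemma linear_line_config: "linear (line_config u)"
  by (rule linearI) (simp_all add: vec_eq_iff scaleR_add_left)

lemma line_config_collision_iff:
  assumes "u \<noteq> 0" shows "line_config u x \<notin> collision_set \<longleftrightarrow> inj (($) x)"
  using assms by (auto simp: collision_set_def inj_def)

text \<open>Positions and mutual forces all point along the line, so normal displacements do not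
  count to first order; planar criticality thus reduces to criticality on the line.\<close>

lemma potential_deriv_line:
  fixes v :: "'n::finite configuration"
  assumes u: "norm u = 1"
  shows "potential_deriv A m (line_config u x) v =
     mass_form m x (\<chi> i. u \<bullet> v $ i) - pair_form A m x x (\<chi> i. u \<bullet> v $ i)"
proof -
  have "norm (x $ i *\<^sub>R u - x $ k *\<^sub>R u) = \<bar>x $ i - x $ k\<bar>" for i k
    using u by (simp add: scaleR_diff_left[symmetric])
  moreover have "(x $ i *\<^sub>R u - x $ k *\<^sub>R u) \<bullet> (v $ i - v $ k) = (x $ i - x $ k) * (u \<bullet> v $ i - u \<bullet> v $ k)" for i k
    by (simp add: scaleR_diff_left[symmetric] inner_diff_right right_diff_distrib)
  ultimately show ?thesis
    by (simp add: potential_deriv_def mass_form_def pair_form_def)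
qed

lemma central_configuration_line_iff:
  fixes x :: "real ^ 'n::{finite,linorder}"
  assumes u: "norm u = 1"
  shows "central_configuration A m (line_config u x) \<longleftrightarrow> inj (($) x) \<and> line_critical A m x"
proof -
  have "u \<noteq> 0" using u by auto
  moreover have "(\<forall>v. potential_deriv A m (line_config u x) v = 0) \<longleftrightarrow> line_critical A m x"
  proof
    assume v: "\<forall>v. potential_deriv A m (line_config u x) v = 0"
    have "mass_form m x h = pair_form A m x x h" for h
    proof -
      have "(\<chi> i. u \<bullet> line_config u h $ i) = h"
        using u by (simp add: vec_eq_iff power2_norm_eq_inner[symmetric])
      then show ?thesis
        using v[rule_format, of "line_config u h"] unfolding potential_deriv_line[OF u] by simp
    qed
    then show "line_critical A m x" by (simp add: line_critical_def)
  qed (simp add: potential_deriv_line[OF u] line_critical_def)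
  ultimately show ?thesis by (simp add: central_configuration_iff line_config_collision_iff)
qed

lemma inj_component_of_strict_mono:
  fixes x :: "real ^ 'n::{finite,linorder}" and \<sigma> :: "'n \<Rightarrow> 'n"
  assumes "bij \<sigma>" and "strict_mono (\<lambda>i. x $ \<sigma> i)"
  shows "inj (($) x)"
proof -
  have "inj (\<lambda>j. x $ \<sigma> (inv \<sigma> j))"
    using inj_compose[OF strict_mono_imp_inj_on[OF assms(2)] bij_is_inj[OF bij_imp_bij_inv[OF assms(1)]]]
    by (simp add: comp_def)
  then show ?thesis using assms(1) by (simp add: bij_is_surj surj_f_inv_f)
qed

text \<open>\<open>on_line_in_order\<close> allows any affine line and any nonzero direction vector.
  Criticality under translations puts the barycentre at the origin, hence the line passes through
  the origin.\<close>

lemma central_configuration_on_line: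
  fixes q :: "'n::{finite,linorder} configuration"
  assumes q: "central_configuration A m q" "on_line_in_order \<sigma> q"
    and m: "\<And>i. m i > 0" and \<sigma>: "bij \<sigma>"
  obtains u x where "norm u = 1" "q = line_config u x" "strict_mono (\<lambda>i. x $ \<sigma> i)" "line_critical A m x"
proof -
  obtain p w t where w: "w \<noteq> 0" and t: "strict_mono t" and pt: "\<And>i. q $ (\<sigma> i) = p + t i *\<^sub>R w"
    using q(2) by (auto simp: on_line_in_order_def)
  let ?M = "total_mass m"
  have M: "?M > 0" by (rule total_mass_pos) (rule m)
  define s where "s j = t (inv \<sigma> j)" for j
  have qs: "q $ j = p + s j *\<^sub>R w" for j
    using pt[of "inv \<sigma> j"] \<sigma> by (simp add: s_def bij_is_surj surj_f_inv_f)
  define c where "c = (\<Sum>i\<in>UNIV. m i *\<^sub>R q $ i)"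
  \<comment> \<open>Under translation by the weighted sum \<open>c\<close> itself the potential
    changes at rate \<open>?M * (c \<bullet> c)\<close>.\<close>
  have "potential_deriv A m q (\<chi> i. c) = 0" using q(1) by (simp add: central_configuration_iff)
  then have "(\<Sum>i\<in>UNIV. m i * (q $ i \<bullet> c)) = 0" using M by (simp add: potential_deriv_def)
  then have "c \<bullet> c = 0" unfolding c_def by (simp add: inner_sum_left)
  then have "c = 0" by simp
  then have "?M *\<^sub>R p + (\<Sum>i\<in>UNIV. m i * s i) *\<^sub>R w = 0"
    by (simp add: c_def qs total_mass_def scaleR_add_right sum.distrib scaleR_sum_left)
  then have "?M *\<^sub>R p = (- (\<Sum>i\<in>UNIV. m i * s i)) *\<^sub>R w"
    by (simp add: add_eq_0_iff2)
  then have "(1 / ?M) *\<^sub>R ?M *\<^sub>R p = (1 / ?M) *\<^sub>R (- (\<Sum>i\<in>UNIV. m i * s i)) *\<^sub>R w"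
    by (rule arg_cong)
  then obtain \<alpha> where \<alpha>: "p = \<alpha> *\<^sub>R w" using M by (auto simp del: scaleR_minus_left)
  define u where "u = (1 / norm w) *\<^sub>R w"
  \<comment> \<open>The factor \<open>norm w\<close> compensates for the unit direction; being
    positive, it keeps the order.\<close>
  define x where "x = (\<chi> j. (\<alpha> + s j) * norm w)"
  have u: "norm u = 1" using w by (simp add: u_def)
  have qx: "q = line_config u x"
    using w by (simp add: vec_eq_iff qs x_def u_def \<alpha> algebra_simps)
  have "strict_mono (\<lambda>i. x $ \<sigma> i)"
    using t w \<sigma> by (auto simp: strict_mono_def x_def s_def bij_is_inj)
  moreover have "line_critical A m x"
    using q(1) unfolding qx central_configuration_line_iff[OF u] by simp
  ultimately show thesis using that u qx by blast
qed

section \<open>Uniqueness for a given order\<close>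

lemma powr_mult_antimono_diff:
  fixes s t :: real
  assumes A: "A \<ge> 1" and st: "s * t > 0"
  shows "(\<bar>s\<bar> powr (- A) * s - \<bar>t\<bar> powr (- A) * t) * (s - t) \<le> 0"
proof -
  have pos: "(a powr (- A) * a - b powr (- A) * b) * (a - b) \<le> 0" if "a > 0" "b > 0" for a b :: real
  proof -
    \<comment> \<open>The force is a power with exponent \<open>1 - A\<close>, nonincreasing for
      \<open>A \<ge> 1\<close>; negative separations reduce to positive ones by oddness.\<close>
    have e: "c powr (- A) * c = c powr (1 - A)" if "c > 0" for c
      using that by (simp add: powr_diff powr_minus field_simps)
    have "b powr (1 - A) \<le> a powr (1 - A)" if "0 < a" "a \<le> b" for a b
      using that A by (intro powr_mono2') auto
    from this[of a b] this[of b a] show ?thesis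
      using that by (cases "a \<le> b") (auto simp: e intro: mult_nonneg_nonpos mult_nonpos_nonneg)
  qed
  show ?thesis
  proof (cases "s > 0")
    case True
    then have "t > 0" using st by (simp add: zero_less_mult_iff)
    then show ?thesis using True pos[of s t] by simp
  next
    case False
    then have "s < 0" "t < 0" using st by (auto simp: zero_less_mult_iff)
    then show ?thesis using pos[of "- s" "- t"] by (simp add: algebra_simps)
  qed
qed

text \<open>Subtract the two critical equations tested with \<open>x - y\<close>. The mass form
  gives a positive amount, the pair terms at most 0: the common order gives corresponding
  separations the same sign, and on each side of 0 the force is nonincreasing.\<close>

lemma line_critical_unique:
  fixes x y :: "real ^ 'n::{finite,linorder}" and \<sigma> :: "'n \<Rightarrow> 'n"
  assumes x: "line_critical A m x" "strict_mono (\<lambda>i. x $ \<sigma> i)"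
    and y: "line_critical A m y" "strict_mono (\<lambda>i. y $ \<sigma> i)"
    and A: "A \<ge> 1" and m: "\<And>i. m i > 0" and \<sigma>: "bij \<sigma>"
  shows "x = y"
proof (rule ccontr)
  assume "x \<noteq> y"
  define h where "h = x - y"
  have "0 < mass_form m h h" using mass_form_pos[of m h] m \<open>x \<noteq> y\<close> by (simp add: h_def)
  also have "\<dots> = mass_form m x h - mass_form m y h"
    unfolding h_def by (rule bilinear_lsub[OF bilinear_mass_form])
  also have "\<dots> = pair_form A m x x h - pair_form A m y y h"
    using x(1) y(1) by (simp add: line_critical_def)
  also have "\<dots> = (\<Sum>i\<in>UNIV. \<Sum>k\<in>UNIV. m i * m k *
      ((\<bar>x $ i - x $ k\<bar> powr (- A) * (x $ i - x $ k) - \<bar>y $ i - y $ k\<bar> powr (- A) * (y $ i - y $ k))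
        * ((x $ i - x $ k) - (y $ i - y $ k)))) / 2"
    unfolding pair_form_def diff_divide_distrib[symmetric] sum_subtractf[symmetric]
    by (intro arg_cong2[of _ _ _ _ "(/)"] sum.cong refl) (simp add: h_def algebra_simps)
  also have "\<dots> \<le> 0"
  proof -
    have *: "(\<bar>x $ i - x $ k\<bar> powr (- A) * (x $ i - x $ k) - \<bar>y $ i - y $ k\<bar> powr (- A) * (y $ i - y $ k))
        * ((x $ i - x $ k) - (y $ i - y $ k)) \<le> 0" for i k
    proof (cases "i = k")
      case False
      obtain i' k' where ik: "i = \<sigma> i'" "k = \<sigma> k'" using \<sigma> by (meson bij_pointE)
      then have "i' \<noteq> k'" using False by auto
      then have "(x $ i - x $ k) * (y $ i - y $ k) > 0"
        using strict_monoD[OF x(2), of i' k'] strict_monoD[OF x(2), of k' i']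
          strict_monoD[OF y(2), of i' k'] strict_monoD[OF y(2), of k' i'] ik
        by (cases "i' < k'") (auto simp: zero_less_mult_iff)
      then show ?thesis by (rule powr_mult_antimono_diff[OF A])
    qed simp
    have "(\<Sum>i\<in>UNIV. \<Sum>k\<in>UNIV. m i * m k *
      ((\<bar>x $ i - x $ k\<bar> powr (- A) * (x $ i - x $ k) - \<bar>y $ i - y $ k\<bar> powr (- A) * (y $ i - y $ k))
        * ((x $ i - x $ k) - (y $ i - y $ k)))) \<le> 0"
      by (intro sum_nonpos mult_nonneg_nonpos[OF _ *] mult_nonneg_nonneg less_imp_le[OF m])
    then show ?thesis by simp
  qed
  finally show False by simp
qed


section \<open>Existence by minimisation over ordered configurations\<close>

lemma pair_energy_ge: "r \<ge> 0 \<Longrightarrow> A \<ge> 2 \<Longrightarrow> - r \<le> pair_energy A r"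
  using ln_le_minus_one[of r] by (cases "r = 0") (auto simp: pair_energy_def intro: order_trans[of _ 0])

lemma pair_energy_unbounded:
  assumes A: "A \<ge> 2"
  shows "\<exists>\<delta>>0. \<forall>r. 0 < r \<and> r < \<delta> \<longrightarrow> K < pair_energy A r"
proof (cases "A = 2")
  case True
  have "K < - ln r" if "0 < r" "r < exp (- K)" for r
    using that ln_less_cancel_iff[of r "exp (- K)"] by simp
  then show ?thesis using True by (intro exI[of _ "exp (- K)"]) (auto simp: pair_energy_def)
next
  case False
  \<comment> \<open>The truncation at 1 makes \<open>L\<close> positive for every \<open>K\<close>,
    so that \<open>\<delta> powr (2 - A) = L\<close> can be solved.\<close>
  define L where "L = max 1 (K * (A - 2))"
  have L: "L > 0" by (simp add: L_def)
  define \<delta> where "\<delta> = L powr (1 / (2 - A))"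
  have "K < r powr (2 - A) / (A - 2)" if "0 < r" "r < \<delta>" for r
  proof -
    have "L = \<delta> powr (2 - A)" using L False by (simp add: \<delta>_def powr_powr)
    also have "\<dots> < r powr (2 - A)" using that A False by (intro powr_less_mono2_neg) auto
    finally have "K * (A - 2) < r powr (2 - A)" by (simp add: L_def)
    then show ?thesis using A False by (simp add: pos_less_divide_eq)
  qed
  moreover have "\<delta> > 0" using L by (simp add: \<delta>_def)
  ultimately show ?thesis using False by (auto simp: pair_energy_def)
qed

lemma potential_line_config:
  assumes "norm u = 1"
  shows "potential A m (line_config u x) =
     mass_form m x x / 2 + (\<Sum>i\<in>UNIV. \<Sum>k\<in>UNIV. m i * m k * pair_energy A \<bar>x $ i - x $ k\<bar>) / 2"
  using assms
  by (simp add: potential_eq mass_form_def scaleR_diff_left[symmetric] power2_norm_eq_inner[symmetric]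
      power2_eq_square)

lemma has_derivative_potential_line:
  assumes u: "norm u = 1" and x: "inj (($) x)"
  shows "((\<lambda>x. potential A m (line_config u x)) has_derivative (\<lambda>h. mass_form m x h - pair_form A m x x h)) (at x)"
proof -
  have "u \<noteq> 0" using u by auto
  then have nc: "line_config u x \<notin> collision_set" using x by (simp add: line_config_collision_iff)
  have "(line_config u has_derivative line_config u) (at x)"
    using linear_line_config
    by (intro bounded_linear_imp_has_derivative) (simp add: linear_conv_bounded_linear)
  from has_derivative_compose[OF this has_derivative_potential[OF nc]]
  have "((\<lambda>x. potential A m (line_config u x)) has_derivative
     (\<lambda>h. potential_deriv A m (line_config u x) (line_config u h))) (at x)" .
  moreover have "u \<bullet> u = 1" using u by (simp add: norm_eq_1)
  ultimately show ?thesis unfolding potential_deriv_line[OF u] by simp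
qed

text \<open>A sublevel set in the open cone \<open>C\<close> lies in a compact subset of
  \<open>C\<close>: the quadratic mass form bounds it, and the blow-up of the pair energy keeps the
  bodies apart. A minimum over the compact set is then one over \<open>C\<close>, where the
  derivative must vanish.\<close>

lemma line_critical_exists:
  fixes m :: "'n::{finite,linorder} \<Rightarrow> real" and \<sigma> :: "'n \<Rightarrow> 'n"
  assumes A: "A \<ge> 2" and m: "\<And>i. m i > 0" and \<sigma>: "bij \<sigma>"
  shows "\<exists>x. strict_mono (\<lambda>i. x $ \<sigma> i) \<and> line_critical A m x"
proof -
  let ?M = "total_mass m"
  have M: "?M > 0" by (rule total_mass_pos) (rule m)
  define u :: "real ^ 2" where "u = axis 1 1"
  have u: "norm u = 1" by (simp add: u_def norm_axis_1)
  define g where "g x = potential A m (line_config u x)" for x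
  define C where "C = {x :: (real, 'n) vec. strict_mono (\<lambda>i. x $ \<sigma> i)}"
  define \<mu> where "\<mu> = Min (range m)"
  have \<mu>: "\<mu> > 0" using m by (simp add: \<mu>_def)
  have \<mu>_le: "\<mu> \<le> m i" for i by (simp add: \<mu>_def)
  have mm: "m i * m k > 0" for i k using m by simp
  have "C = (\<Inter>(i, k)\<in>{(i, k). i < k}. {x. x $ \<sigma> i < x $ \<sigma> k})"
    by (auto simp: C_def strict_mono_def)
  then have "open C"
    by (simp only:) (intro open_INT, auto intro!: open_Collect_less continuous_intros)
  \<comment> \<open>The reference point places the bodies at 0, 1, 2, ... in the prescribed
    order.\<close>
  define x0 where "x0 = (\<chi> j. real (card {l. l < inv \<sigma> j}))"
  have "card {l. l < i} < card {l. l < k}" if "i < k" for i k :: 'n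
    by (rule psubset_card_mono) (use that in auto)
  then have x0: "x0 \<in> C" using \<sigma> by (simp add: C_def x0_def strict_mono_def bij_is_inj)
  have dist_le: "\<bar>x $ i - x $ k\<bar> \<le> 2 * norm x" for x :: "(real, 'n) vec" and i k
    using component_le_norm_cart[of x i] component_le_norm_cart[of x k] by linarith
  have sum_dist_le: "(\<Sum>i\<in>UNIV. \<Sum>k\<in>UNIV. m i * m k * \<bar>x $ i - x $ k\<bar>) \<le> 2 * ?M\<^sup>2 * norm x" for x
  proof -
    have "(\<Sum>i\<in>UNIV. \<Sum>k\<in>UNIV. m i * m k * \<bar>x $ i - x $ k\<bar>) \<le> (\<Sum>i\<in>UNIV. \<Sum>k\<in>UNIV. m i * m k * (2 * norm x))"
      by (intro sum_mono mult_left_mono dist_le less_imp_le[OF mm])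
    also have "\<dots> = 2 * ?M\<^sup>2 * norm x"
      by (simp add: total_mass_def power2_eq_square sum_product sum_distrib_left sum_distrib_right mult_ac)
    finally show ?thesis .
  qed
  have mass_ge: "?M * \<mu> * (norm x)\<^sup>2 \<le> mass_form m x x" for x
  proof -
    have "\<mu> * (norm x)\<^sup>2 \<le> (\<Sum>i\<in>UNIV. m i * (x $ i * x $ i))"
      unfolding power2_norm_eq_inner inner_vec_def sum_distrib_left
      by (intro sum_mono) (simp add: mult_right_mono \<mu>_le)
    then show ?thesis using M by (simp add: mass_form_def mult.assoc)
  qed
  \<comment> \<open>Adding the distance makes every pair term nonnegative, by
    \<open>pair_energy_ge\<close>, so a single pair is bounded by the whole sum. The cost is linear
    in \<open>norm x\<close>.\<close>
  define P where "P x = (\<Sum>i\<in>UNIV. \<Sum>k\<in>UNIV. m i * m k * (pair_energy A \<bar>x $ i - x $ k\<bar> + \<bar>x $ i - x $ k\<bar>))" for x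
  have P_term: "m i * m k * (pair_energy A \<bar>x $ i - x $ k\<bar> + \<bar>x $ i - x $ k\<bar>) \<ge> 0" for x i k
    using pair_energy_ge[of "\<bar>x $ i - x $ k\<bar>" A] A by (intro mult_nonneg_nonneg less_imp_le[OF m]) auto
  have g_ge: "mass_form m x x + P x \<le> 2 * g x + 2 * ?M\<^sup>2 * norm x" for x
  proof -
    have "mass_form m x x + P x = 2 * g x + (\<Sum>i\<in>UNIV. \<Sum>k\<in>UNIV. m i * m k * \<bar>x $ i - x $ k\<bar>)"
      unfolding g_def potential_line_config[OF u] P_def
      by (simp add: distrib_left sum.distrib)
    then show ?thesis using sum_dist_le[of x] by simp
  qed
  \<comment> \<open>Beyond \<open>R\<close> the term \<open>?M * \<mu> * (norm x)\<^sup>2\<close>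
    exceeds \<open>2 * ?M\<^sup>2 * norm x + 2 * \<bar>g x0\<bar>\<close>. The summand 1 ensures
    \<open>norm x > 1\<close>, which absorbs the constant.\<close>
  define R where "R = (?M\<^sup>2 + \<bar>g x0\<bar>) / (?M * \<mu> / 2) + 1"
  have bounded: "norm x \<le> R" if "g x \<le> g x0" for x
  proof (rule ccontr)
    assume "\<not> norm x \<le> R"
    then have 1: "(?M\<^sup>2 + \<bar>g x0\<bar>) / (?M * \<mu> / 2) < norm x" and "(?M\<^sup>2 + \<bar>g x0\<bar>) / (?M * \<mu> / 2) + 1 < norm x"
      by (auto simp: R_def)
    moreover have "(?M\<^sup>2 + \<bar>g x0\<bar>) / (?M * \<mu> / 2) \<ge> 0" using M \<mu> by simp
    ultimately have 2: "norm x > 1" by linarith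
    have 3: "\<bar>g x0\<bar> < ?M * \<mu> / 2 * norm x - ?M\<^sup>2"
      using 1 M \<mu> by (subst (asm) pos_divide_less_eq) (auto simp: mult.commute)
    then have "1 * \<bar>g x0\<bar> < norm x * (?M * \<mu> / 2 * norm x - ?M\<^sup>2)"
      using 2 by (intro mult_strict_mono') auto
    moreover have "P x \<ge> 0" unfolding P_def by (intro sum_nonneg P_term)
    ultimately show False
      using g_ge[of x] mass_ge[of x] that by (simp add: algebra_simps power2_eq_square)
  qed
  \<comment> \<open>On the sublevel set \<open>P x\<close> is at most the number inside the bars,
    and every pair has weight at least \<open>\<mu>\<^sup>2\<close>, so no pair energy exceeds
    \<open>K\<close>. The bars ensure \<open>K \<ge> 0\<close>.\<close>
  define K where "K = \<bar>2 * g x0 + 2 * ?M\<^sup>2 * R\<bar> / \<mu>\<^sup>2"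
  obtain \<delta> where \<delta>: "\<delta> > 0" "\<And>r. 0 < r \<Longrightarrow> r < \<delta> \<Longrightarrow> K < pair_energy A r"
    using pair_energy_unbounded[OF A, of K] by blast
  have separated: "\<delta> \<le> x $ k - x $ i" if gx: "g x \<le> g x0" and ik: "x $ i < x $ k" for x i k
  proof (rule ccontr)
    assume "\<not> \<delta> \<le> x $ k - x $ i"
    then have K: "K < pair_energy A \<bar>x $ i - x $ k\<bar>" using ik by (intro \<delta>) auto
    have K0: "K \<ge> 0" by (simp add: K_def)
    have "\<bar>2 * g x0 + 2 * ?M\<^sup>2 * R\<bar> = \<mu>\<^sup>2 * K" using \<mu> by (simp add: K_def)
    also have "\<dots> < \<mu>\<^sup>2 * pair_energy A \<bar>x $ i - x $ k\<bar>" using K \<mu> by simp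
    also have "\<dots> \<le> m i * m k * pair_energy A \<bar>x $ i - x $ k\<bar>"
      unfolding power2_eq_square using K K0 \<mu> \<mu>_le less_imp_le[OF m] by (intro mult_right_mono mult_mono) auto
    also have "\<dots> \<le> m i * m k * (pair_energy A \<bar>x $ i - x $ k\<bar> + \<bar>x $ i - x $ k\<bar>)"
      by (intro mult_left_mono less_imp_le[OF mm]) simp
    also have "\<dots> \<le> (\<Sum>k\<in>UNIV. m i * m k * (pair_energy A \<bar>x $ i - x $ k\<bar> + \<bar>x $ i - x $ k\<bar>))"
      by (rule member_le_sum) (auto intro: P_term)
    also have "\<dots> \<le> P x"
      unfolding P_def by (rule member_le_sum[of i]) (auto intro!: sum_nonneg P_term)
    also have "\<dots> \<le> 2 * g x0 + 2 * ?M\<^sup>2 * R"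
    proof -
      have "mass_form m x x \<ge> 0" using mass_ge[of x] M \<mu> by (meson mult_nonneg_nonneg less_imp_le order_trans zero_le_power2)
      moreover have "?M\<^sup>2 * norm x \<le> ?M\<^sup>2 * R" using bounded[OF gx] by (intro mult_left_mono) auto
      ultimately show ?thesis using g_ge[of x] gx by linarith
    qed
    finally show False by simp
  qed
  \<comment> \<open>Gaps of at least \<open>\<delta>\<close> are a closed condition, which makes
    \<open>D\<close> compact, and still imply the strict order, which keeps \<open>D\<close> inside
    \<open>C\<close>.\<close>
  define D where "D = cball 0 R \<inter> (\<Inter>(i, k)\<in>{(i, k). i < k}. {x. \<delta> \<le> x $ \<sigma> k - x $ \<sigma> i})"
  have D: "x \<in> D" if "x \<in> C" "g x \<le> g x0" for x
    using bounded[OF that(2)] separated[OF that(2)] that(1) by (auto simp: D_def C_def strict_mono_def)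
  have DC: "D \<subseteq> C" using \<delta>(1) by (force simp: D_def C_def strict_mono_def)
  have deriv: "(g has_derivative (\<lambda>h. mass_form m x h - pair_form A m x x h)) (at x)" if "x \<in> C" for x
    unfolding g_def
    by (rule has_derivative_potential_line[OF u inj_component_of_strict_mono[OF \<sigma>]]) (use that in \<open>simp add: C_def\<close>)
  have "compact D"
    unfolding D_def
    by (intro compact_Int_closed compact_cball closed_INT) (auto intro!: closed_Collect_le continuous_intros)
  moreover have "D \<noteq> {}" using D[OF x0] by auto
  moreover have "continuous_on D g"
    using deriv DC by (intro continuous_at_imp_continuous_on ballI) (blast intro: has_derivative_continuous)
  ultimately obtain y where y: "y \<in> D" "\<And>x. x \<in> D \<Longrightarrow> g y \<le> g x"
    using continuous_attains_inf[of D g] by metis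
  have "g y \<le> g x" if "x \<in> C" for x
    using y(2)[of x] y(2)[OF D[OF x0]] D[OF that] by force
  moreover have yC: "y \<in> C" using y DC by blast
  ultimately have "(\<lambda>h. mass_form m y h - pair_form A m y y h) = (\<lambda>h. 0)"
    by (intro differential_zero_maxmin[OF _ \<open>open C\<close> deriv]) auto
  then have "line_critical A m y" by (simp add: line_critical_def fun_eq_iff)
  then show ?thesis using yC by (auto simp: C_def)
qed

section \<open>The Morse index\<close>

lemma perp_nth [simp]: "perp u $ 1 = - u $ 2" "perp u $ 2 = u $ 1"
  by (simp_all add: perp_def)

lemma norm_perp [simp]: "norm (perp u) = norm u"
  by (simp add: norm_eq_sqrt_inner inner_vec_def sum_2)

lemma inner_perp [simp]: "u \<bullet> perp u = 0" "perp u \<bullet> u = 0"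
  by (simp_all add: inner_vec_def sum_2)

lemma inner_decomposition:
  assumes "norm u = 1"
  shows "v \<bullet> w = (u \<bullet> v) * (u \<bullet> w) + (perp u \<bullet> v) * (perp u \<bullet> w)"
proof -
  have "u $ 1 * u $ 1 + u $ 2 * u $ 2 = 1"
    using assms by (simp add: norm_eq_1 inner_vec_def sum_2)
  then have "(v $ 1 * w $ 1 + v $ 2 * w $ 2) * 1 = (v $ 1 * w $ 1 + v $ 2 * w $ 2) * (u $ 1 * u $ 1 + u $ 2 * u $ 2)"
    by simp
  then show ?thesis by (simp add: inner_vec_def sum_2 algebra_simps)
qed

lemma rotate_config_eq:
  "rotate_config \<theta> q = cos \<theta> *\<^sub>R q + sin \<theta> *\<^sub>R (\<chi> i. perp (q $ i))"
  by (simp add: rotate_config_def vec_eq_iff forall_2)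

text \<open>The derivative of the rotation at angle 0 is the quarter turn, which moves the bodies
  normally to the line by \<open>x\<close>.\<close>

lemma orbit_tangent_line: "orbit_tangent (line_config u x) = span {line_config (perp u) x}"
proof -
  let ?q = "line_config u x"
  have "((\<lambda>\<theta>. rotate_config \<theta> ?q) has_vector_derivative (- sin 0) *\<^sub>R ?q + cos 0 *\<^sub>R (\<chi> i. perp (?q $ i))) (at 0)"
    unfolding rotate_config_eq
    by (rule has_vector_derivative_eq_rhs) (auto intro!: derivative_eq_intros)
  moreover have "(\<chi> i. perp (?q $ i)) = line_config (perp u) x"
    by (simp add: vec_eq_iff forall_2)
  ultimately show ?thesis
    by (simp add: orbit_tangent_def vector_derivative_at)
qed

text \<open>All separations are parallel to \<open>u\<close>, so the components \<open>a\<close> and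
  \<open>b\<close> decouple. Differentiating the factor \<open>norm z powr (- A)\<close> of the
  force affects only \<open>a\<close>, whose pair form gets the coefficient \<open>A - 1\<close>
  instead of -1.\<close>

lemma hessian_line:
  fixes x :: "real ^ 'n::{finite,linorder}" and v :: "'n configuration"
  assumes u: "norm u = 1" and x: "inj (($) x)"
  defines "a \<equiv> \<chi> i. u \<bullet> v $ i" and "b \<equiv> \<chi> i. perp u \<bullet> v $ i"
  shows "hessian (potential A m) (line_config u x) v v =
     mass_form m a a + mass_form m b b + (A - 1) * pair_form A m x a a - pair_form A m x b b"
proof -
  let ?q = "line_config u x"
  have "u \<noteq> 0" using u by auto
  then have nc: "?q \<notin> collision_set" using x by (simp add: line_config_collision_iff)
  have summand: "norm (?q $ i - ?q $ k) powr (- A) * ((v $ i - v $ k) \<bullet> (v $ i - v $ k))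
       - A * norm (?q $ i - ?q $ k) powr (- A - 2) * ((?q $ i - ?q $ k) \<bullet> (v $ i - v $ k))
             * ((?q $ i - ?q $ k) \<bullet> (v $ i - v $ k))
     = \<bar>x $ i - x $ k\<bar> powr (- A) * ((b $ i - b $ k) * (b $ i - b $ k))
       - (A - 1) * (\<bar>x $ i - x $ k\<bar> powr (- A) * ((a $ i - a $ k) * (a $ i - a $ k)))" for i k
  proof (cases "i = k")
    case False
    define d where "d = x $ i - x $ k"
    have "d \<noteq> 0" using False x by (auto simp: d_def dest: injD)
    have e: "?q $ i - ?q $ k = d *\<^sub>R u" by (simp add: d_def scaleR_diff_left)
    have n: "norm (d *\<^sub>R u) = \<bar>d\<bar>" using u by simp
    \<comment> \<open>Two factors \<open>d\<close>, one from each inner product, cancel the extra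
      exponent -2.\<close>
    have p: "\<bar>d\<bar> powr (- A - 2) * (d * d) = \<bar>d\<bar> powr (- A)"
      using \<open>d \<noteq> 0\<close> by (simp add: powr_diff power2_eq_square)
    have ab: "(v $ i - v $ k) \<bullet> (v $ i - v $ k) = (a $ i - a $ k) * (a $ i - a $ k) + (b $ i - b $ k) * (b $ i - b $ k)"
      by (subst inner_decomposition[OF u]) (simp add: a_def b_def inner_diff_right)
    have i: "(d *\<^sub>R u) \<bullet> (v $ i - v $ k) = d * (a $ i - a $ k)"
      by (simp add: a_def inner_diff_right right_diff_distrib)
    have "A * \<bar>d\<bar> powr (- A - 2) * (d * (a $ i - a $ k)) * (d * (a $ i - a $ k))
       = A * (\<bar>d\<bar> powr (- A - 2) * (d * d)) * ((a $ i - a $ k) * (a $ i - a $ k))"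
      by (simp add: mult_ac)
    then show ?thesis
      unfolding e n i ab d_def[symmetric] p by (simp add: algebra_simps)
  qed simp
  have "hessian (potential A m) ?q v v = total_mass m * (\<Sum>i\<in>UNIV. m i * (v $ i \<bullet> v $ i))
     - (\<Sum>i\<in>UNIV. \<Sum>k\<in>UNIV. m i * m k *
          (\<bar>x $ i - x $ k\<bar> powr (- A) * ((b $ i - b $ k) * (b $ i - b $ k))
       - (A - 1) * (\<bar>x $ i - x $ k\<bar> powr (- A) * ((a $ i - a $ k) * (a $ i - a $ k))))) / 2"
    unfolding hessian_potential[OF nc] summand ..
  also have "total_mass m * (\<Sum>i\<in>UNIV. m i * (v $ i \<bullet> v $ i)) = mass_form m a a + mass_form m b b"
    by (subst inner_decomposition[OF u])
      (simp add: mass_form_def a_def b_def distrib_left sum.distrib)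
  also have "(\<Sum>i\<in>UNIV. \<Sum>k\<in>UNIV. m i * m k *
          (\<bar>x $ i - x $ k\<bar> powr (- A) * ((b $ i - b $ k) * (b $ i - b $ k))
       - (A - 1) * (\<bar>x $ i - x $ k\<bar> powr (- A) * ((a $ i - a $ k) * (a $ i - a $ k))))) / 2
     = pair_form A m x b b - (A - 1) * pair_form A m x a a"
    by (simp only: pair_form_def right_diff_distrib[of "m _ * m _"] sum_subtractf diff_divide_distrib
        mult.left_commute[of "m _ * m _" "A - 1"] sum_distrib_left[symmetric] times_divide_eq_right)
  finally show ?thesis by simp
qed

text \<open>Normal displacements by centred vectors form a space of the required dimension modulo
  rotations. No competitor is larger, since taking the centred normal component is injective on
  it.\<close>

lemma morse_index_line:
  fixes x :: "real ^ 'n::{finite,linorder}"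
  assumes u: "norm u = 1" and inj: "inj (($) x)" and crit: "line_critical A m x"
    and A: "A \<ge> 1" and m: "\<And>i. m i > 0" and N: "CARD('n) \<ge> 2"
  shows "morse_index A m (line_config u x) = CARD('n) - 2"
proof -
  let ?q = "line_config u x" and ?N = "CARD('n)" and ?M = "total_mass m"
  let ?L = "line_config (perp u) :: (real, 'n) vec \<Rightarrow> _"
  let ?K = "orbit_tangent ?q"
  have M: "?M > 0" by (rule total_mass_pos) (rule m)
  have pu: "norm (perp u) = 1" using u by simp
  have puu: "perp u \<bullet> perp u = 1" using pu by (simp only: norm_eq_1)
  have K: "?K = span {?L x}" by (rule orbit_tangent_line)
  \<comment> \<open>Two bodies at different places show that \<open>x\<close> is not constant, which
    makes the rotation direction nonzero.\<close>
  obtain i0 k0 :: 'n where ik: "i0 \<noteq> k0"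
    using N card_2_iff'[of "UNIV :: 'n set"] card_le_Suc0_iff_eq[of "UNIV :: 'n set"] by fastforce
  then have x_ik: "x $ i0 \<noteq> x $ k0" using inj by (auto dest: injD)
  have comp: "(\<chi> i. perp u \<bullet> ?L y $ i) = y" "(\<chi> i. u \<bullet> ?L y $ i) = 0" for y
    using puu by (simp_all add: vec_eq_iff)
  have inj_L: "inj ?L" using comp(1) by (metis injI)
  have "?L x \<noteq> 0"
  proof
    assume "?L x = 0"
    then have "?L x = ?L 0" using linear_0[OF linear_line_config] by metis
    then have "x = 0" by (rule injD[OF inj_L])
    then show False using x_ik by simp
  qed
  then have dim_K: "dim ?K = 1" unfolding K by simp
  define H where "H = {y :: (real, 'n) vec. (\<chi> i. m i) \<bullet> y = 0}"
  have H_iff: "y \<in> H \<longleftrightarrow> (\<Sum>i\<in>UNIV. m i * y $ i) = 0" for y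
    by (simp add: H_def inner_vec_def)
  have "(\<chi> i. m i) \<noteq> 0" using m by (auto simp: vec_eq_iff less_le)
  then have dim_H: "dim H = ?N - 1" unfolding H_def by (simp add: dim_hyperplane)
  have sub_H: "subspace H" unfolding H_def by (rule subspace_hyperplane)
  have upper: "dim W \<le> ?N - 1"
    if W: "subspace W" and neg: "\<forall>w\<in>W - ?K. hessian (potential A m) ?q w w < 0" for W
  proof -
    \<comment> \<open>\<open>T\<close> removes the weighted mean from the normal component. On its
      kernel that component is constant, so the Hessian is nonnegative and the kernel meets
      \<open>W\<close> only in rotations; a nonzero rotation has a nonconstant normal
      component.\<close>
    define T where "T v = (\<chi> i. perp u \<bullet> v $ i - (\<Sum>k\<in>UNIV. m k * (perp u \<bullet> v $ k)) / ?M)" for v :: "'n configuration"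
    have T: "linear T"
    proof (rule linearI)
      show "T (v + w) = T v + T w" for v w
        by (simp add: T_def vec_eq_iff inner_add_right distrib_left sum.distrib add_divide_distrib)
      show "T (c *\<^sub>R v) = c *\<^sub>R T v" for c v
        by (simp add: T_def vec_eq_iff mult.left_commute[of _ c] sum_distrib_left[symmetric] right_diff_distrib)
    qed
    have "T v \<in> H" for v
    proof -
      have "(\<Sum>i\<in>UNIV. m i * T v $ i) = (\<Sum>i\<in>UNIV. m i * (perp u \<bullet> v $ i)) - ?M * ((\<Sum>k\<in>UNIV. m k * (perp u \<bullet> v $ k)) / ?M)"
        unfolding T_def total_mass_def sum_distrib_right by (simp add: right_diff_distrib sum_subtractf)
      then show ?thesis using M by (simp add: H_iff)
    qed
    then have "T ` W \<subseteq> H" by blast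
    moreover have "inj_on T W"
      unfolding linear_injective_on_subspace_0[OF T W]
    proof (intro ballI impI)
      fix v assume v: "v \<in> W" "T v = 0"
      define c where "c = (\<Sum>k\<in>UNIV. m k * (perp u \<bullet> v $ k)) / ?M"
      have b: "perp u \<bullet> v $ i = c" for i
      proof -
        have "T v $ i = perp u \<bullet> v $ i - c" by (simp add: T_def c_def)
        then show ?thesis using v(2) by simp
      qed
      let ?a = "\<chi> i. u \<bullet> v $ i" and ?b = "\<chi> i. perp u \<bullet> v $ i"
      have "pair_form A m x ?b ?b = 0" by (simp add: pair_form_def b)
      moreover have "pair_form A m x ?a ?a \<ge> 0" by (rule pair_form_nonneg[OF m])
      moreover have "mass_form m y y \<ge> 0" for y
        using mass_form_pos[of m y] m by (cases "y = 0") (auto simp: mass_form_def)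
      ultimately have "hessian (potential A m) ?q v v \<ge> 0"
        unfolding hessian_line[OF u inj] using A by simp
      then have "v \<in> ?K" using neg v(1) by force
      then obtain s where s: "v = s *\<^sub>R ?L x" unfolding K by (auto simp: span_singleton)
      then have "perp u \<bullet> v $ i = s * x $ i" for i using puu by simp
      then have "s * x $ i0 = s * x $ k0" using b by metis
      then show "v = 0" using x_ik s by simp
    qed
    then have "dim (T ` W) = dim W"
      using W by (intro dim_image_eq[OF T]) (simp add: span_eq_iff[THEN iffD2])
    ultimately show ?thesis using dim_subset[of "T ` W" H] dim_H by simp
  qed
  let ?W = "?L ` H"
  have W_sub: "subspace ?W" by (rule linear_subspace_image[OF linear_line_config sub_H])
  have "x \<in> H" using line_critical_barycenter[OF crit m] by (simp add: H_iff)
  then have W_K: "?K \<subseteq> ?W" unfolding K by (intro span_minimal W_sub) auto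
  have W_neg: "hessian (potential A m) ?q w w < 0" if w: "w \<in> ?W - ?K" for w
  proof -
    obtain y where y: "y \<in> H" "w = ?L y" using w by blast
    have "y \<notin> span {x}"
    proof
      assume "y \<in> span {x}"
      then obtain s where "y = s *\<^sub>R x" by (auto simp: span_singleton)
      then have "w = s *\<^sub>R ?L x" using y linear_cmul[OF linear_line_config] by simp
      then show False using w unfolding K by (auto simp: span_singleton)
    qed
    then have "mass_form m y y < pair_form A m x y y"
      using y A by (intro pair_form_gt_mass_form[OF crit _ m inj]) (auto simp: H_iff)
    then show ?thesis
      unfolding hessian_line[OF u inj] y(2) comp
      by (simp add: bilinear_lzero[OF bilinear_mass_form] bilinear_lzero[OF bilinear_pair_form])
  qed
  have dim_W: "dim ?W = ?N - 1"
    using dim_image_eq[OF linear_line_config inj_on_subset[OF inj_L subset_UNIV]] dim_H by metis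
  show ?thesis
    unfolding morse_index_def
  proof (rule Max_eqI)
    let ?S = "{dim W - dim ?K | W. subspace W \<and> ?K \<subseteq> W \<and> (\<forall>w\<in>W - ?K. hessian (potential A m) ?q w w < 0)}"
    show le: "d \<le> ?N - 2" if "d \<in> ?S" for d
      using that upper dim_K by fastforce
    \<comment> \<open>The upper bound also gives the finiteness that \<open>Max\<close>
      requires.\<close>
    have "?S \<subseteq> {..?N - 2}" using le by blast
    then show "finite ?S" by (rule finite_subset) simp
    have "?N - 2 = dim ?W - dim ?K" using dim_W dim_K by simp
    then show "?N - 2 \<in> ?S" using W_sub W_K W_neg by blast
  qed
qed

section \<open>Rotation classes\<close>

lemma rotate_config_0: "rotate_config 0 q = q"
  by (simp add: rotate_config_eq)

lemma rotate_config_add: "rotate_config \<alpha> (rotate_config \<beta> q) = rotate_config (\<alpha> + \<beta>) q"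
  by (simp add: rotate_config_def vec_eq_iff forall_2 cos_add sin_add algebra_simps)

lemma equiv_rotation_relation: "equiv (- collision_set) rotation_relation"
proof (rule equivI)
  show "rotation_relation \<subseteq> (- collision_set) \<times> (- collision_set)"
    by (auto simp: rotation_relation_def)
  show "refl_on (- collision_set) rotation_relation"
    by (auto simp: refl_on_def rotation_relation_def intro!: exI[of _ 0] simp: rotate_config_0)
  show "sym rotation_relation"
  proof (rule symI)
    fix q q' assume "(q, q') \<in> rotation_relation"
    then obtain \<theta> where "q \<notin> collision_set" "q' \<notin> collision_set" "q' = rotate_config \<theta> q"
      by (auto simp: rotation_relation_def)
    moreover from this have "q = rotate_config (- \<theta>) q'"
      by (simp add: rotate_config_add rotate_config_0)
    ultimately show "(q', q) \<in> rotation_relation"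
      unfolding rotation_relation_def by blast
  qed
  show "trans rotation_relation"
  proof (rule transI)
    fix q q' r assume "(q, q') \<in> rotation_relation" "(q', r) \<in> rotation_relation"
    then obtain \<theta> \<eta> where "q \<notin> collision_set" "r \<notin> collision_set" "r = rotate_config \<eta> (rotate_config \<theta> q)"
      by (auto simp: rotation_relation_def)
    then show "(q, r) \<in> rotation_relation"
      unfolding rotation_relation_def rotate_config_add by blast
  qed
qed

text \<open>Every unit direction, the opposite one included, is a rotated first axis, so the
  direction of the line is immaterial in the configuration space.\<close>

lemma line_config_rotation:
  assumes "norm u = 1"
  shows "\<exists>\<theta>. line_config u x = rotate_config \<theta> (line_config (axis 1 1) x)"
proof -
  have "(u $ 1)\<^sup>2 + (u $ 2)\<^sup>2 = 1"
    using assms by (simp add: norm_eq_1 inner_vec_def sum_2 power2_eq_square)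
  then obtain \<theta> where "u $ 1 = cos \<theta>" "u $ 2 = sin \<theta>"
    using sincos_total_2pi by metis
  then have "line_config u x = rotate_config \<theta> (line_config (axis 1 1) x)"
    by (simp add: rotate_config_def vec_eq_iff forall_2 axis_def)
  then show ?thesis ..
qed

theorem theorem6:
  fixes A :: real
    and m :: "'n::{finite,linorder} \<Rightarrow> real"
    and \<sigma> :: "'n \<Rightarrow> 'n"
  assumes "A \<ge> 2"
    and "CARD('n) \<ge> 2"
    and "\<And>i. m i > 0"
    and "bij \<sigma>"
  shows "(\<exists>!c. c \<in> configuration_space \<and>
               (\<exists>q\<in>c. central_configuration A m q \<and> on_line_in_order \<sigma> q)) \<and>
         (\<forall>q. central_configuration A m q \<and> on_line_in_order \<sigma> q \<longrightarrow>
               morse_index A m q = CARD('n) - 2)"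
proof (intro conjI allI impI)
  have A: "A \<ge> 1" using assms(1) by simp
  obtain x where x: "strict_mono (\<lambda>i. x $ \<sigma> i)" "line_critical A m x"
    using line_critical_exists[of A m \<sigma>] assms by blast
  define e :: "real ^ 2" where "e = axis 1 1"
  have e: "norm e = 1" by (simp add: e_def)
  define q where "q = line_config e x"
  have "central_configuration A m q"
    using inj_component_of_strict_mono[OF assms(4) x(1)] x(2)
    by (simp add: q_def central_configuration_line_iff[OF e])
  moreover have "on_line_in_order \<sigma> q"
    unfolding on_line_in_order_def q_def
    by (rule exI[of _ 0], rule exI[of _ e], rule exI[of _ "\<lambda>i. x $ \<sigma> i"]) (use e x in auto)
  moreover have nc: "q \<notin> collision_set" using calculation by (simp add: central_configuration_def)
  ultimately show "\<exists>!c. c \<in> configuration_space \<and> (\<exists>q\<in>c. central_configuration A m q \<and> on_line_in_order \<sigma> q)"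
  proof (intro ex1I[of _ "rotation_relation `` {q}"] conjI)
    show "rotation_relation `` {q} \<in> configuration_space"
      unfolding configuration_space_def using nc by (intro quotientI) simp
    show "\<exists>q\<in>rotation_relation `` {q}. central_configuration A m q \<and> on_line_in_order \<sigma> q"
      if "central_configuration A m q" "on_line_in_order \<sigma> q"
      using that equiv_class_self[OF equiv_rotation_relation, of q] nc by blast
    fix c assume "c \<in> configuration_space \<and> (\<exists>q\<in>c. central_configuration A m q \<and> on_line_in_order \<sigma> q)"
    then obtain r q' where c: "c = rotation_relation `` {r}" "q' \<in> c"
      and q': "central_configuration A m q'" "on_line_in_order \<sigma> q'"
      unfolding configuration_space_def by (auto elim!: quotientE)
    obtain u y where y: "norm u = 1" "q' = line_config u y" "strict_mono (\<lambda>i. y $ \<sigma> i)" "line_critical A m y"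
      by (rule central_configuration_on_line[OF q' assms(3,4)])
    \<comment> \<open>Equal coordinates leave only the direction of the line free, and changing it
      is a rotation.\<close>
    have "y = x" by (rule line_critical_unique[OF y(4,3) x(2,1) A assms(3,4)])
    then have "\<exists>\<theta>. q' = rotate_config \<theta> q"
      using line_config_rotation[OF y(1), of x] y(2) by (simp add: q_def e_def)
    then have "(q, q') \<in> rotation_relation"
      using nc q'(1) by (simp add: rotation_relation_def central_configuration_def)
    then have "rotation_relation `` {q} = rotation_relation `` {q'}"
      by (rule equiv_class_eq[OF equiv_rotation_relation])
    moreover have "rotation_relation `` {r} = rotation_relation `` {q'}"
      using c by (intro equiv_class_eq[OF equiv_rotation_relation]) simp
    ultimately show "c = rotation_relation `` {q}" using c(1) by simp
  qed
next
  fix q assume "central_configuration A m q \<and> on_line_in_order \<sigma> q"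
  then have q: "central_configuration A m q" "on_line_in_order \<sigma> q" by simp_all
  obtain u y where y: "norm u = 1" "q = line_config u y" "strict_mono (\<lambda>i. y $ \<sigma> i)" "line_critical A m y"
    by (rule central_configuration_on_line[OF q assms(3,4)])
  then show "morse_index A m q = CARD('n) - 2"
    using morse_index_line[OF y(1) inj_component_of_strict_mono[OF assms(4) y(3)] y(4)] assms by simp
qed

end
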